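(* There exists an online algorithm which, on $n$-vertex general (not necessarily bipartite) graphs revealed vertex by vertex, whose maximum degree $\Delta$ is unknown but is known to satisfy $\Delta\ge\Delta'$ for a known $\Delta'=\omega(\log n)$, computes with high probability a proper edge coloring using $(1.777+o(1))\cdot\Delta$ colors.
   Context: Online edge coloring under (general) vertex arrivals: vertices arrive one at a time in an order fixed in advance (oblivious adversary); when a vertex arrives, all its edges to previously arrived vertices are revealed, and the algorithm must immediately and irrevocably color each of these edges so that no two edges sharing an endpoint have the same color. The maximum degree $\Delta$ of the final graph is not known to the algorithm; only the lower bound $\Delta'$ is known. *)

theory Defs
  imports "HOL-Probability.Probability" "HOL-Library.Landau_Symbols"
begin

definition simple_graph :: "'v set \<Rightarrow> 'v set set \<Rightarrow> bool" where
  "simple_graph V E \<longleftrightarrow> finite V \<and> (\<forall>e\<in>E. e \<subseteq> V \<and> card e = 2)"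

definition degree :: "'v set set \<Rightarrow> 'v \<Rightarrow> nat" where
  "degree E v = card {e \<in> E. v \<in> e}"

text \<open>The inserted \<open>0\<close> only matters for the graph without vertices.\<close>

definition max_degree :: "'v set \<Rightarrow> 'v set set \<Rightarrow> nat" where
  "max_degree V E = Max (insert 0 (degree E ` V))"

definition proper_edge_coloring :: "'v set set \<Rightarrow> ('v set \<Rightarrow> nat) \<Rightarrow> bool" where
  "proper_edge_coloring E col \<longleftrightarrow>
     (\<forall>e\<in>E. \<forall>f\<in>E. e \<noteq> f \<and> e \<inter> f \<noteq> {} \<longrightarrow> col e \<noteq> col f)"

definition arrival_order :: "'v set \<Rightarrow> 'v list \<Rightarrow> bool" where
  "arrival_order V vs \<longleftrightarrow> distinct vs \<and> set vs = V"

text \<open>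
  The algorithm knows a vertex by its arrival time. The arrival of the vertex number \<open>t\<close>
  reveals the arrival times of its neighbours among the earlier vertices, and
  \<open>revealed E vs t\<close> is everything revealed up to and including that arrival.
\<close>

definition back_neighbours :: "'v set set \<Rightarrow> 'v list \<Rightarrow> nat \<Rightarrow> nat set" where
  "back_neighbours E vs t = {s. s < t \<and> {vs ! s, vs ! t} \<in> E}"

definition revealed :: "'v set set \<Rightarrow> 'v list \<Rightarrow> nat \<Rightarrow> nat set list" where
  "revealed E vs t = map (back_neighbours E vs) [0..<Suc t]"

text \<open>
  If \<open>h\<close> is what has been revealed when a vertex arrives, a deterministic online algorithm
  \<open>alg\<close> gives the colour \<open>alg h s\<close> to the edge between the new vertex and its neighbour
  number \<open>s\<close>. Its own earlier choices are functions of prefixes of \<open>h\<close>, so they need not be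
  passed to it. As the colour depends on \<open>h\<close> and \<open>s\<close> only, it is fixed once and for all at
  that arrival.

  A randomized online algorithm is a probability distribution on deterministic ones; it
  may depend on the number \<open>n\<close> of vertices (first argument) and on the known lower bound on
  the maximum degree (second argument). On \<open>n\<close> vertices only finitely many \<open>h\<close> occur, hence
  only countably many behaviours, and discrete distributions are fully general. The graph
  and the arrival order are fixed before the deterministic algorithm is drawn
  (oblivious adversary).
\<close>

type_synonym det_online_algorithm = "nat set list \<Rightarrow> nat \<Rightarrow> nat"

type_synonym online_algorithm = "nat \<Rightarrow> nat \<Rightarrow> det_online_algorithm pmf"

definition edge_color ::
  "det_online_algorithm \<Rightarrow> 'v set set \<Rightarrow> 'v list \<Rightarrow> 'v set \<Rightarrow> nat" where
  "edge_color alg E vs e =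
     (THE c. \<exists>s t. s < t \<and> t < length vs \<and> e = {vs ! s, vs ! t} \<and> c = alg (revealed E vs t) s)"

lemma edge_color_eq:
  assumes "distinct vs" "s < t" "t < length vs"
  shows "edge_color alg E vs {vs ! s, vs ! t} = alg (revealed E vs t) s"
  unfolding edge_color_def
proof (rule the_equality)
  show "\<exists>s' t'. s' < t' \<and> t' < length vs \<and> {vs ! s, vs ! t} = {vs ! s', vs ! t'} \<and>
      alg (revealed E vs t) s = alg (revealed E vs t') s'"
    using assms by blast
next
  fix c
  assume "\<exists>s' t'. s' < t' \<and> t' < length vs \<and> {vs ! s, vs ! t} = {vs ! s', vs ! t'} \<and>
      c = alg (revealed E vs t') s'"
  then obtain s' t' where *: "s' < t'" "t' < length vs" "{vs ! s, vs ! t} = {vs ! s', vs ! t'}"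
      "c = alg (revealed E vs t') s'"
    by blast
  from * assms have "s = s' \<and> t = t'"
    by (auto simp: doubleton_eq_iff nth_eq_iff_index_eq)
  with * show "c = alg (revealed E vs t) s"
    by simp
qed

end

theory Submission imports Defs begin

text \<open>
  A fractional edge colouring is computed online and then rounded.

  Fractional part. When a vertex arrives while \<open>D\<close> is the larger of the known bound and the
  current maximum degree, every new edge spreads one unit over the colours below \<open>1.777 D\<close>, as
  evenly as possible with respect to the load of its older endpoint. Plain water filling with
  a cap \<open>\<beta>/D\<close> on the share of a colour needs \<open>\<beta> (\<alpha> \<beta> - 1 - ln (\<alpha> \<beta> - 1)) \<le> 1\<close> for \<open>\<alpha> D\<close>
  colours, and the smallest such \<open>\<alpha>\<close> is \<open>1.77701\<dots>\<close>, slightly too large. Therefore the cap is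
  relaxed: shares may reach \<open>0.97/D\<close>, as long as the total excess over \<open>0.78/D\<close> is at most
  \<open>0.12\<close>. Then no load exceeds \<open>0.99\<close>. Take the set \<open>S\<close> of most loaded colours at the end. Since
  water filling preserves the order of the loads, the colours outside \<open>S\<close> were always less
  loaded than those in \<open>S\<close>, so an edge puts mass on \<open>S\<close> at its older endpoint only
  after using all it may put outside. Summing over the edges of a vertex bounds the mass of \<open>S\<close>.

  Rounding. An edge \<open>uv\<close> with shares \<open>x c\<close> gets colour \<open>c\<close> with probability proportional to
  \<open>x c * phi u c * phi v c\<close>, where \<open>phi v c\<close> drops to \<open>0\<close> once \<open>c\<close> is used at \<open>v\<close> and otherwise is
  divided by the probability of not using \<open>c\<close>. So each \<open>phi v c\<close> is a martingale, and
  exponential supermartingales show that the normalisation of every edge stays close to \<open>1\<close> and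
  that no \<open>phi v c\<close> becomes large, up to an error probability exponentially small in the known
  degree bound. The slack between \<open>0.99\<close> and \<open>1\<close> pays for all deviations, so that no
  lower-order term is needed in the number of colours.

  A behaviour strategy, which draws each colour given the past, is turned into a distribution
  on deterministic algorithms by drawing all answers to all possible pasts independently in
  advance.
\<close>

section \<open>Water filling with relaxed caps\<close>

definition ncol :: "nat \<Rightarrow> nat" where
  "ncol D = 1777 * D div 1000"

definition spread :: "nat \<Rightarrow> (nat \<Rightarrow> real) set" where
  "spread D = {x. (\<forall>c. 0 \<le> x c \<and> x c \<le> 97 / (100 * real D)) \<and> (\<forall>c\<ge>ncol D. x c = 0) \<and>
     (\<Sum>c<ncol D. max 0 (x c - 39 / (50 * real D))) \<le> 3/25 \<and> (\<Sum>c<ncol D. x c) = 1}"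

text \<open>Water filling is encoded as least squares: moving a little mass from a higher to a lower
  final level decreases the sum of squares, so a minimiser admits no feasible move of this
  kind.\<close>

definition energy :: "(nat \<Rightarrow> real) \<Rightarrow> nat \<Rightarrow> (nat \<Rightarrow> real) \<Rightarrow> real" where
  "energy L D x = (\<Sum>c<ncol D. (L c + x c)\<^sup>2)"

definition is_level :: "(nat \<Rightarrow> real) \<Rightarrow> nat \<Rightarrow> (nat \<Rightarrow> real) \<Rightarrow> bool" where
  "is_level L D x \<longleftrightarrow> x \<in> spread D \<and> (\<forall>y\<in>spread D. energy L D x \<le> energy L D y)"

definition level :: "(nat \<Rightarrow> real) \<Rightarrow> nat \<Rightarrow> nat \<Rightarrow> real" where
  "level L D = (SOME x. is_level L D x)"

text \<open>Rounding down loses less than one colour, and one colour is at most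
  \<open>D / 1000\<close> here.\<close>

lemma ncol_ge: "1000 \<le> D \<Longrightarrow> 1.776 * real D \<le> real (ncol D)"
proof -
  assume "1000 \<le> D"
  then have "1776 * D \<le> 1000 * ncol D" unfolding ncol_def by linarith
  then have "real (1776 * D) \<le> real (1000 * ncol D)" by (simp only: of_nat_le_iff)
  then show ?thesis by simp
qed

lemma ncol_le: "real (ncol D) \<le> 1.777 * real D"
proof -
  have "1000 * ncol D \<le> 1777 * D" unfolding ncol_def by linarith
  then have "real (1000 * ncol D) \<le> real (1777 * D)" by (simp only: of_nat_le_iff)
  then show ?thesis by simp
qed

lemma ncol_mono: "D \<le> D' \<Longrightarrow> ncol D \<le> ncol D'"
  unfolding ncol_def by (intro div_le_mono) simp

text \<open>Shares are functions on all of \<open>nat\<close>, so compactness comes from Tychonoff: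
  a product of intervals is cut by conditions that are closed because coordinates are
  continuous.\<close>

lemma compact_spread: "compact (spread D)"
proof -
  let ?B = "{x :: nat \<Rightarrow> real. \<forall>c. 0 \<le> x c \<and> x c \<le> 97 / (100 * real D)}"
  have "compactin (product_topology (\<lambda>_. euclidean) UNIV) (PiE UNIV (\<lambda>_::nat. {0..97 / (100 * real D)}))"
    by (subst compactin_PiE) auto
  moreover have "PiE UNIV (\<lambda>_::nat. {0..97 / (100 * real D)}) = ?B"
    by (auto simp: PiE_def extensional_def)
  ultimately have B: "compact ?B"
    by (simp add: euclidean_product_topology)
  have eq: "spread D = ?B \<inter> ({x. \<forall>c\<in>{ncol D..}. x c = 0} \<inter>
     {x. (\<Sum>c<ncol D. max 0 (x c - 39 / (50 * real D))) \<le> 3/25} \<inter> {x. (\<Sum>c<ncol D. x c) = 1})"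
    unfolding spread_def by auto
  have "closed {x :: nat \<Rightarrow> real. \<forall>c\<in>{ncol D..}. x c = 0}"
  proof -
    have "{x :: nat \<Rightarrow> real. \<forall>c\<in>{ncol D..}. x c = 0} = (\<Inter>c\<in>{ncol D..}. {x. x c = 0})" by auto
    then show ?thesis
      by (auto intro!: closed_INT closed_Collect_eq continuous_intros continuous_on_product_coordinates)
  qed
  moreover have "closed {x :: nat \<Rightarrow> real. (\<Sum>c<ncol D. max 0 (x c - 39 / (50 * real D))) \<le> 3/25}"
    by (intro closed_Collect_le continuous_intros continuous_on_product_coordinates)
  moreover have "closed {x :: nat \<Rightarrow> real. (\<Sum>c<ncol D. x c) = 1}"
    by (intro closed_Collect_eq continuous_intros continuous_on_product_coordinates)
  ultimately show ?thesis
    unfolding eq by (intro compact_Int_closed[OF B] closed_Int)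
qed

text \<open>The uniform distribution works: its shares are at most \<open>1 / (1.776 * D)\<close>,
  so it has no excess over \<open>39 / (50 * D)\<close>.\<close>

lemma spread_nonempty:
  assumes "1000 \<le> D"
  shows "spread D \<noteq> {}"
proof -
  define m where "m = ncol D"
  have m: "1.776 * real D \<le> real m" using ncol_ge[OF assms] m_def by simp
  then have mpos: "0 < real m" using assms by (cases "m = 0") auto
  have a: "1 / real m \<le> 39 / (50 * real D)"
    using m mpos assms by (simp add: field_simps)
  have "39 / (50 * real D) \<le> 97 / (100 * real D)"
    using assms by (simp add: field_simps)
  with a have "(\<lambda>c. if c < m then 1 / real m else 0) \<in> spread D"
    unfolding spread_def m_def[symmetric] using mpos by auto
  then show ?thesis by auto
qed

lemma level:
  assumes "1000 \<le> D"
  shows "is_level L D (level L D)"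
proof -
  have "continuous_on (spread D) (energy L D)"
    unfolding energy_def
    by (intro continuous_intros continuous_on_subset[OF continuous_on_product_coordinates] subset_UNIV)
  from continuous_attains_inf[OF compact_spread spread_nonempty[OF assms] this]
  have "\<exists>x. is_level L D x" unfolding is_level_def by blast
  then show ?thesis unfolding level_def by (rule someI_ex)
qed

section \<open>Exchange arguments for shares of minimal energy\<close>

lemma sum_two_points:
  fixes f :: "nat \<Rightarrow> real"
  assumes "finite A" "c \<in> A" "w \<in> A" "c \<noteq> w"
  shows "sum f A = f c + f w + sum f (A - {c, w})"
proof -
  have "sum f A = f c + sum f (A - {c})" using assms by (simp add: sum.remove)
  moreover have "sum f (A - {c}) = f w + sum f (A - {c} - {w})" using assms by (intro sum.remove) auto
  moreover have "A - {c} - {w} = A - {c, w}" by auto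
  ultimately show ?thesis by simp
qed

text \<open>Moving mass \<open>e\<close> from \<open>c\<close> to \<open>w\<close> changes two terms
  of each sum. Assumption \<open>ex\<close> is the excess budget after the move, with the two old
  terms carried to the right.\<close>

lemma transfer_in_spread:
  assumes x: "x \<in> spread D" and cw: "c < ncol D" "w < ncol D" "c \<noteq> w"
    and e: "0 < e" "e \<le> x c" "x w + e \<le> 97 / (100 * real D)"
    and ex: "(\<Sum>k<ncol D. max 0 (x k - 39 / (50 * real D))) + max 0 (x c - e - 39 / (50 * real D))
      + max 0 (x w + e - 39 / (50 * real D)) \<le> 3/25 + max 0 (x c - 39 / (50 * real D)) + max 0 (x w - 39 / (50 * real D))"
  shows "x(c := x c - e, w := x w + e) \<in> spread D"
proof -
  let ?y = "x(c := x c - e, w := x w + e)"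
  have xs: "\<And>k. 0 \<le> x k" "\<And>k. x k \<le> 97 / (100 * real D)" "\<And>k. k \<ge> ncol D \<Longrightarrow> x k = 0"
    "(\<Sum>k<ncol D. x k) = 1"
    using x unfolding spread_def by auto
  have r: "sum (\<lambda>k. f (?y k)) ({..<ncol D} - {c, w}) = sum (\<lambda>k. f (x k)) ({..<ncol D} - {c, w})"
    for f :: "real \<Rightarrow> real"
    by (intro sum.cong) auto
  have t: "sum (\<lambda>k. f (?y k)) {..<ncol D} =
      sum (\<lambda>k. f (x k)) {..<ncol D} - f (x c) - f (x w) + f (x c - e) + f (x w + e)"
    for f :: "real \<Rightarrow> real"
    using sum_two_points[of "{..<ncol D}" c w "\<lambda>k. f (?y k)"] r[of f]
      sum_two_points[of "{..<ncol D}" c w "\<lambda>k. f (x k)"] cw by simp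
  have "(\<Sum>k<ncol D. ?y k) = 1"
    using t[of "\<lambda>z. z"] xs(4) by simp
  moreover have "(\<Sum>k<ncol D. max 0 (?y k - 39 / (50 * real D))) \<le> 3/25"
    using t[of "\<lambda>z. max 0 (z - 39 / (50 * real D))"] ex by linarith
  moreover have "\<forall>k. 0 \<le> ?y k \<and> ?y k \<le> 97 / (100 * real D)"
    using xs(1,2) e cw(3) by (auto intro: order_trans[of "x c - e" "x c"] add_nonneg_nonneg)
  moreover have "\<forall>k\<ge>ncol D. ?y k = 0" using cw xs(3) by auto
  ultimately show ?thesis unfolding spread_def by blast
qed

text \<open>If \<open>gap\<close> is the difference of the final levels, the move changes the energy
  by \<open>- 2 * e * (gap - e)\<close>, which is negative.\<close>

lemma level_not_improvable:
  assumes x: "is_level L D x" and cw: "c < ncol D" "w < ncol D"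
    and e: "0 < e" "e < (L c + x c) - (L w + x w)"
  shows "x(c := x c - e, w := x w + e) \<notin> spread D"
proof
  let ?y = "x(c := x c - e, w := x w + e)"
  assume "?y \<in> spread D"
  then have le: "energy L D x \<le> energy L D ?y" using x unfolding is_level_def by blast
  have ne: "c \<noteq> w" using e by auto
  have r: "sum (\<lambda>k. (L k + ?y k)\<^sup>2) ({..<ncol D} - {c, w}) = sum (\<lambda>k. (L k + x k)\<^sup>2) ({..<ncol D} - {c, w})"
    by (intro sum.cong) auto
  have "energy L D ?y = energy L D x - (L c + x c)\<^sup>2 - (L w + x w)\<^sup>2 + (L c + x c - e)\<^sup>2 + (L w + x w + e)\<^sup>2"
    unfolding energy_def
    using sum_two_points[of "{..<ncol D}" c w "\<lambda>k. (L k + ?y k)\<^sup>2"] r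
      sum_two_points[of "{..<ncol D}" c w "\<lambda>k. (L k + x k)\<^sup>2"] cw ne by (simp add: algebra_simps)
  also have "\<dots> = energy L D x - 2 * e * ((L c + x c) - (L w + x w) - e)"
    by (simp add: power2_eq_square algebra_simps)
  also have "\<dots> < energy L D x" using e by simp
  finally show False using le by simp
qed

text \<open>Otherwise \<open>x w < x c\<close>, and moving mass from \<open>c\<close> to
  \<open>w\<close> brings the two shares closer. This does not increase the excess, which is convex,
  but lowers the energy.\<close>

lemma level_order_preserving:
  assumes x: "is_level L D x" and w: "w < ncol D" and lt: "L w + x w < L c + x c"
  shows "L w < L c"
proof (rule ccontr)
  assume "\<not> L w < L c"
  then have xcw: "x w < x c" using lt by linarith
  have xs: "x \<in> spread D" using x unfolding is_level_def by simp
  then have nn: "\<And>k. 0 \<le> x k" "\<And>k. x k \<le> 97 / (100 * real D)" "\<And>k. k \<ge> ncol D \<Longrightarrow> x k = 0"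
    and exc: "(\<Sum>c<ncol D. max 0 (x c - 39 / (50 * real D))) \<le> 3/25"
    unfolding spread_def by auto
  have c: "c < ncol D" using nn(1)[of w] nn(3)[of c] xcw by (cases "c < ncol D") auto
  define e where "e = min ((x c - x w) / 2) ((L c + x c - (L w + x w)) / 2)"
  have e: "0 < e" "2 * e \<le> x c - x w" "e < L c + x c - (L w + x w)"
    unfolding e_def using xcw lt by (auto simp: min_def)
  have "x(c := x c - e, w := x w + e) \<in> spread D"
  proof (rule transfer_in_spread[OF xs c w])
    show "c \<noteq> w" using xcw by auto
    show "e \<le> x c" using e nn(1)[of w] by linarith
    show "x w + e \<le> 97 / (100 * real D)" using e nn(2)[of c] by linarith
    show "(\<Sum>k<ncol D. max 0 (x k - 39 / (50 * real D))) + max 0 (x c - e - 39 / (50 * real D))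
      + max 0 (x w + e - 39 / (50 * real D)) \<le> 3/25 + max 0 (x c - 39 / (50 * real D)) + max 0 (x w - 39 / (50 * real D))"
      using exc e by linarith
  qed (use e in auto)
  with level_not_improvable[OF x c w e(1,3)] show False by simp
qed

text \<open>A colour of \<open>S\<close> with positive share would pass mass to a less loaded colour
  outside \<open>S\<close> if the caps allowed it. So either all outside shares are at the hard cap,
  or the excess budget is used up, and then entirely outside \<open>S\<close>, where all shares are
  at least the soft cap. These are the two entries of \<open>min\<close>.\<close>

lemma level_saturates:
  assumes x: "is_level L D x" and D: "0 < D"
    and sep: "\<And>c w. c \<in> S \<Longrightarrow> w \<in> {..<ncol D} - S \<Longrightarrow> L w + x w < L c + x c"
    and pos: "c \<in> S" "0 < x c"
  shows "min (97 / (100 * real D) * card ({..<ncol D} - S)) (39 / (50 * real D) * card ({..<ncol D} - S) + 3/25)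
    \<le> sum x ({..<ncol D} - S)"
proof -
  define W where "W = {..<ncol D} - S"
  define h where "h = 39 / (50 * real D)"
  define H where "H = 97 / (100 * real D)"
  have hH: "h < H" using D unfolding h_def H_def by (simp add: field_simps)
  have xs: "x \<in> spread D" using x unfolding is_level_def by simp
  then have nn: "\<And>k. 0 \<le> x k" "\<And>k. x k \<le> H" "\<And>k. k \<ge> ncol D \<Longrightarrow> x k = 0"
    and exc: "(\<Sum>c<ncol D. max 0 (x c - h)) \<le> 3/25"
    unfolding spread_def h_def H_def by auto
  have blocked: "\<not> (e \<le> x c' \<and> x w + e \<le> H \<and> (\<Sum>k<ncol D. max 0 (x k - h)) + max 0 (x c' - e - h)
      + max 0 (x w + e - h) \<le> 3/25 + max 0 (x c' - h) + max 0 (x w - h))"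
    if "c' \<in> S" "0 < x c'" "w \<in> W" "0 < e" "e < L c' + x c' - (L w + x w)" for c' w e
  proof -
    have c': "c' < ncol D" using nn(3)[of c'] that(2) by (cases "c' < ncol D") auto
    have w: "w < ncol D" "c' \<noteq> w" using that unfolding W_def by auto
    show ?thesis
      using transfer_in_spread[OF xs c' w(1) w(2) that(4)] level_not_improvable[OF x c' w(1) that(4,5)]
      unfolding h_def H_def by blast
  qed
  have sepW: "\<And>c w. c \<in> S \<Longrightarrow> w \<in> W \<Longrightarrow> 0 < L c + x c - (L w + x w)"
    using sep unfolding W_def by fastforce
  show ?thesis
  proof (cases "\<forall>w\<in>W. x w = H")
    case True
    then have "sum x W = H * card W" by simp
    then show ?thesis unfolding W_def H_def by simp
  next
    case False
    then obtain w0 where w0: "w0 \<in> W" "x w0 < H" using nn(2) by (force simp: less_le)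
    have tight: "(\<Sum>k<ncol D. max 0 (x k - h)) = 3/25"
    proof (rule ccontr)
      assume "\<not> ?thesis"
      then have lt: "(\<Sum>k<ncol D. max 0 (x k - h)) < 3/25" using exc by simp
      define e where "e = min (min (x c) (H - x w0)) (min (3/25 - (\<Sum>k<ncol D. max 0 (x k - h)))
          ((L c + x c - (L w0 + x w0)) / 2))"
      have "0 < e" "e \<le> x c" "e \<le> H - x w0" "e \<le> 3/25 - (\<Sum>k<ncol D. max 0 (x k - h))"
        "e < L c + x c - (L w0 + x w0)"
        using pos w0 lt sepW[OF pos(1) w0(1)] unfolding e_def by (auto simp: min_def)
      with blocked[OF pos w0(1), of e] show False
        by linarith
    qed
    \<comment> \<open>Mass above \<open>h\<close> at \<open>c'\<close> could move to
      \<open>w0\<close>: the excess freed at \<open>c'\<close> pays for the excess created at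
      \<open>w0\<close>.\<close>
    have small: "x c' \<le> h" if c': "c' \<in> S" for c'
    proof (rule ccontr)
      assume "\<not> ?thesis"
      then have lt: "h < x c'" by simp
      have hp: "0 < h" using D unfolding h_def by simp
      define e where "e = min (min (x c' - h) (H - x w0)) ((L c' + x c' - (L w0 + x w0)) / 2)"
      have "0 < e" "e \<le> x c' - h" "e \<le> H - x w0" "e < L c' + x c' - (L w0 + x w0)"
        using w0 lt sepW[OF c' w0(1)] unfolding e_def by (auto simp: min_def)
      with blocked[OF c' _ w0(1), of e] exc lt hp show False
        by linarith
    qed
    \<comment> \<open>Below \<open>h\<close> a colour receives mass without touching the excess
      budget.\<close>
    have large: "h \<le> x w" if w: "w \<in> W" for w
    proof (rule ccontr)
      assume "\<not> ?thesis"
      then have lt: "x w < h" by simp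
      define e where "e = min (min (x c) (h - x w)) ((L c + x c - (L w + x w)) / 2)"
      have "0 < e" "e \<le> x c" "e \<le> h - x w" "e < L c + x c - (L w + x w)"
        using lt pos sepW[OF pos(1) w] unfolding e_def by (auto simp: min_def)
      with blocked[OF pos w, of e] exc lt hH show False
        by linarith
    qed
    have "(\<Sum>k<ncol D. max 0 (x k - h)) = (\<Sum>k\<in>W. max 0 (x k - h))"
      using small unfolding W_def by (intro sum.mono_neutral_right) auto
    also have "\<dots> = (\<Sum>k\<in>W. x k - h)" using large by (intro sum.cong) (auto simp: max_def)
    also have "\<dots> = sum x W - h * card W" by (simp add: sum_subtractf)
    finally have "sum x W = h * card W + 3/25" using tight by simp
    then show ?thesis unfolding W_def h_def by simp
  qed
qed

section \<open>The mass collected by a set of colours\<close>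

text \<open>
  In terms of \<open>s = card S\<close>, an edge that arrives at degree bound \<open>D\<close> adds at most
  \<open>birth_share s D\<close> to the mass of \<open>S\<close> at its newer and \<open>forward_share s D\<close> at its older
  endpoint. With \<open>1.776 D\<close> colours, \<open>1579/3125 = 0.78 * 1.776 + 0.12 - 1\<close>; the linear expression
  reaches \<open>0.88\<close> at \<open>D = 39/44 s\<close> and \<open>0\<close> at \<open>D = 4875/3158 s\<close>. The function \<open>forward_mass\<close> is
  its integral, and \<open>mass_cap s D d\<close> bounds the mass at a vertex of degree \<open>d\<close> that arrived at
  degree bound \<open>D\<close>.
\<close>

definition forward_share :: "real \<Rightarrow> real \<Rightarrow> real" where
  "forward_share s D = (if D < 39/44 * s then 1 else max 0 (39/50 * s / D - 1579/3125))"

definition clip :: "real \<Rightarrow> real \<Rightarrow> real" where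
  "clip s y = min (max y (39/44 * s)) (4875/3158 * s)"

definition primitive :: "real \<Rightarrow> real \<Rightarrow> real" where
  "primitive s y = 39/50 * s * ln y - 1579/3125 * y"

definition forward_mass :: "real \<Rightarrow> real \<Rightarrow> real" where
  "forward_mass s y = primitive s (clip s y) - primitive s (39/44 * s) + min y (39/44 * s)"

definition birth_share :: "real \<Rightarrow> real \<Rightarrow> real" where
  "birth_share s D = min 1 (min (39/50 * s / D + 3/25) (97/100 * s / D))"

definition mass_cap :: "real \<Rightarrow> real \<Rightarrow> real \<Rightarrow> real" where
  "mass_cap s D d = (if d \<le> D then birth_share s D * d else birth_share s D * D + forward_mass s d - forward_mass s D)"

text \<open>The derivative of \<open>primitive s\<close> decreases, so an increment is at least the
  length of the interval times the derivative at its right end. This is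
  \<open>ln z \<le> z - 1\<close> at \<open>z = a / b\<close>.\<close>

lemma primitive_increment:
  assumes "0 < s" "0 < a" "a \<le> b"
  shows "(b - a) * (39/50 * s / b - 1579/3125) \<le> primitive s b - primitive s a"
proof -
  have b: "0 < b" using assms by linarith
  have "ln (a / b) \<le> a / b - 1" using assms b by (intro ln_le_minus_one) auto
  then have "(b - a) / b \<le> ln b - ln a" using assms b by (simp add: ln_div diff_divide_distrib)
  then have "39/50 * s * ((b - a) / b) \<le> 39/50 * s * (ln b - ln a)"
    using assms(1) by (intro mult_left_mono) auto
  moreover have "(b - a) * (39/50 * s / b - 1579/3125) = 39/50 * s * ((b - a) / b) - 1579/3125 * (b - a)"
    using b by (simp add: field_simps)
  ultimately show ?thesis unfolding primitive_def by (simp add: right_diff_distrib)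
qed

text \<open>Integral comparison: the share decreases in the degree bound, so its value at
  \<open>D \<ge> d + 1\<close> is at most its integral from \<open>d\<close> to
  \<open>d + 1\<close>.\<close>

lemma forward_share_le_increment:
  assumes s: "0 < s" and d: "0 \<le> d" "d + 1 \<le> D"
  shows "forward_share s D \<le> forward_mass s (d + 1) - forward_mass s d"
proof -
  define p where "p = 39/44 * s"
  define q where "q = 4875/3158 * s"
  have pq: "0 < p" "p < q" using s unfolding p_def q_def by auto
  define b0 where "b0 = clip s d"
  define b1 where "b1 = clip s (d + 1)"
  have b: "0 < b0" "b0 \<le> b1" "b1 \<le> q" "p \<le> b1" unfolding b0_def b1_def clip_def p_def[symmetric] q_def[symmetric]
    using pq by auto
  have diff: "forward_mass s (d + 1) - forward_mass s d = primitive s b1 - primitive s b0 + (min (d + 1) p - min d p)"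
    unfolding forward_mass_def b0_def b1_def p_def by simp
  have inc: "(b1 - b0) * (39/50 * s / b1 - 1579/3125) \<le> primitive s b1 - primitive s b0"
    using b s by (intro primitive_increment) auto
  have a: "0 \<le> min (d + 1) p - min d p" by auto
  consider "D < p" | "p \<le> D" "D < q" | "q \<le> D" by linarith
  then show ?thesis
  proof cases
    case 1
    then have "b1 = b0" "min (d + 1) p - min d p = 1"
      unfolding b1_def b0_def clip_def p_def[symmetric] q_def[symmetric] using d pq by auto
    then show ?thesis using diff 1 unfolding forward_share_def p_def by simp
  next
    case 2
    define r where "r = 39/50 * s / D - 1579/3125"
    have D: "0 < D" using 2 pq by linarith
    have r0: "0 \<le> r" using 2 D s unfolding r_def q_def by (simp add: field_simps)
    have r1: "r \<le> 1" using 2 D s unfolding r_def p_def by (simp add: field_simps)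
    have b1D: "b1 \<le> D" unfolding b1_def clip_def p_def[symmetric] q_def[symmetric] using d 2 by auto
    have "r \<le> 39/50 * s / b1 - 1579/3125"
      unfolding r_def using b b1D s D by (auto intro!: divide_left_mono mult_pos_pos)
    then have "(b1 - b0) * r \<le> primitive s b1 - primitive s b0"
      using b inc by (meson mult_left_mono diff_ge_0_iff_ge order_trans)
    moreover have "(min (d + 1) p - min d p) * r \<le> min (d + 1) p - min d p"
      using a r1 by (simp add: mult_left_le)
    moreover have "(b1 - b0) + (min (d + 1) p - min d p) = 1"
      unfolding b1_def b0_def clip_def p_def[symmetric] q_def[symmetric] using 2 d pq by auto
    then have "(b1 - b0) * r + (min (d + 1) p - min d p) * r = r"
      by (metis distrib_right mult_1)
    ultimately have "r \<le> forward_mass s (d + 1) - forward_mass s d" using diff by linarith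
    then show ?thesis using 2 r0 unfolding forward_share_def p_def r_def by auto
  next
    case 3
    have D: "0 < D" using 3 pq by linarith
    have "39/50 * s / D - 1579/3125 \<le> 0" using 3 D unfolding q_def by (simp add: field_simps)
    then have "forward_share s D = 0" using 3 pq unfolding forward_share_def p_def by auto
    moreover have "0 \<le> 39/50 * s / b1 - 1579/3125"
      using b pq unfolding q_def by (simp add: field_simps)
    then have "0 \<le> (b1 - b0) * (39/50 * s / b1 - 1579/3125)" using b by (intro mult_nonneg_nonneg) auto
    ultimately show ?thesis using inc diff a by linarith
  qed
qed

text \<open>As long as the degree of a vertex is below the bound at its arrival,
  \<open>mass_cap\<close> charges its forward edges at the birth rate; this makes the charge
  sufficient.\<close>

lemma forward_share_le_birth_share:
  assumes "0 < s" "0 < D" "D \<le> D'"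
  shows "forward_share s D' \<le> birth_share s D"
proof (cases "D' < 39/44 * s")
  case True
  then have "birth_share s D = 1" unfolding birth_share_def using assms by (auto simp: min_def field_simps)
  then show ?thesis using True unfolding forward_share_def by simp
next
  case False
  have D': "0 < D'" using assms by linarith
  have le: "39/50 * s / D' \<le> 39/50 * s / D" using assms D' by (intro divide_left_mono) auto
  have "39/50 * s / D' \<le> 1" using False D' by (simp add: field_simps)
  moreover have "39/50 * s / D \<le> 97/100 * s / D" using assms by (simp add: field_simps)
  moreover have "0 \<le> 97/100 * s / D" "0 \<le> 39/50 * s / D" using assms by auto
  ultimately show ?thesis using False le unfolding forward_share_def birth_share_def by auto
qed

text \<open>The last assumption excludes a step across \<open>D0\<close>; for integers it always
  holds.\<close>

lemma mass_cap_step: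
  assumes "0 < s" "0 < D0" "D0 \<le> D" "0 \<le> d" "d + 1 \<le> D" "d + 1 \<le> D0 \<or> D0 \<le> d"
  shows "mass_cap s D0 d + forward_share s D \<le> mass_cap s D0 (d + 1)"
proof (cases "d + 1 \<le> D0")
  case True
  then show ?thesis using forward_share_le_birth_share[of s D0 D] assms unfolding mass_cap_def by (simp add: algebra_simps)
next
  case False
  then have "D0 \<le> d" using assms by auto
  then show ?thesis using forward_share_le_increment[of s d D] assms unfolding mass_cap_def by auto
qed

text \<open>\<open>1579/2750\<close> is the quotient of the breakpoints \<open>39/44 * s\<close> and
  \<open>4875/3158 * s\<close>. The quadratic Taylor bound is accurate enough at a quarter of the
  exponent, and the fourth power restores it.\<close>

lemma ln_bound: "- (557/1000) \<le> ln (1579/2750 :: real)"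
proof -
  have "(1 + 557/4000 + (557/4000)\<^sup>2 / 2 :: real) \<le> exp (557/4000)"
    by (rule exp_lower_Taylor_quadratic) simp
  then have "(1 + 557/4000 + (557/4000)\<^sup>2 / 2 :: real) ^ 4 \<le> exp (557/4000) ^ 4"
    by (intro power_mono) (auto simp: power2_eq_square)
  also have "exp (557/4000 :: real) ^ 4 = exp (557/1000)"
    by (simp flip: exp_of_nat_mult)
  finally have "(2750/1579 :: real) \<le> exp (557/1000)"
    by (simp add: power2_eq_square power4_eq_xxxx)
  then have "ln (2750/1579 :: real) \<le> ln (exp (557/1000))"
    by (subst ln_le_cancel_iff) auto
  then have "ln (2750/1579 :: real) \<le> 557/1000" by simp
  moreover have "ln (1579/2750 :: real) = - ln (2750/1579)"
    by (simp add: ln_div)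
  ultimately show ?thesis by simp
qed

lemma ln_chord:
  fixes z z0 :: real
  assumes "0 < z0" "z0 \<le> z" "z \<le> 1" "z0 < 1"
  shows "(1 - z) / (1 - z0) * ln z0 \<le> ln z"
proof -
  define t where "t = (1 - z) / (1 - z0)"
  have t: "0 \<le> t" "t \<le> 1" unfolding t_def using assms by (auto simp: field_simps)
  have "t * (1 - z0) = 1 - z" unfolding t_def using assms by simp
  then have z: "z = t * z0 + (1 - t) * 1" by (simp add: algebra_simps)
  have "(1 - t) * ln 1 + t * ln z0 \<le> ln ((1 - t) *\<^sub>R 1 + t *\<^sub>R z0)"
    using t assms(1) by (intro concave_onD[OF ln_concave]) auto
  then show ?thesis using z unfolding t_def[symmetric] by (simp add: add.commute)
qed

text \<open>In terms of \<open>z = D / q\<close> only \<open>ln z\<close> is not affine. Replacing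
  it by its chord leaves an affine inequality, which is tightest at \<open>z = 1579/2750\<close>,
  where the bound is about \<open>0.9887 * s\<close>.\<close>

lemma mass_cap_middle:
  fixes s D :: real
  assumes s: "0 < s" and D: "39/44 * s \<le> D" "D \<le> 4875/3158 * s"
  shows "39/50 * s + 3/25 * D + primitive s (4875/3158 * s) - primitive s D \<le> 99/100 * s"
proof -
  define q where "q = 4875/3158 * s"
  have q: "0 < q" using s q_def by simp
  define z where "z = D / q"
  have Dz: "D = z * q" using q z_def by simp
  have z: "1579/2750 \<le> z" "z \<le> 1" using D q s unfolding z_def q_def by (auto simp: field_simps)
  have "(1 - z) / (1 - 1579/2750) * ln (1579/2750) \<le> ln z" using z by (intro ln_chord) auto
  moreover have "(1 - z) / (1 - 1579/2750) * (- (557/1000)) \<le> (1 - z) / (1 - 1579/2750) * ln (1579/2750)"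
    using z ln_bound by (intro mult_left_mono) auto
  ultimately have lnz: "(1 - z) / (1 - 1579/2750) * (- (557/1000)) \<le> ln z" by linarith
  have hq: "primitive s q - primitive s D = 39/50 * s * (- ln z) - 1579/3125 * (q - D)"
    unfolding primitive_def Dz using q z by (simp add: ln_mult field_simps)
  have "39/50 * s * (- ln z) \<le> 39/50 * s * ((1 - z) / (1 - 1579/2750) * (557/1000))"
    by (rule mult_left_mono) (use lnz s in linarith)+
  moreover have "1579/3125 * (q - D) = 39/50 * s * (1 - z)" "3/25 * D = s * (3/25 * z * (4875/3158))"
    unfolding Dz q_def by (auto simp: field_simps)
  ultimately have "39/50 * s + 3/25 * D + primitive s q - primitive s D \<le> 39/50 * s + s * (3/25 * z * (4875/3158))
      + 39/50 * s * ((1 - z) / (1 - 1579/2750) * (557/1000)) - 39/50 * s * (1 - z)"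
    using hq by linarith
  also have "\<dots> =
     s * (39/50 + 3/25 * z * (4875/3158) + 39/50 * ((1 - z) / (1 - 1579/2750) * (557/1000)) - 39/50 * (1 - z))"
    by (simp add: algebra_simps)
  also have "\<dots> \<le> s * (99/100)"
    using s z by (intro mult_left_mono) (auto simp: field_simps)
  finally show ?thesis unfolding q_def by simp
qed

text \<open>For a birth below \<open>p\<close> the mass up to degree \<open>p\<close> is at most
  \<open>p\<close>, which equals the soft birth cap \<open>39/50 * s + 3/25 * p\<close>; so this
  case reduces to a birth at \<open>p\<close>. Beyond \<open>q\<close> nothing is added forward, and
  the hard cap \<open>97/100 * s\<close> suffices.\<close>

lemma mass_cap_le:
  assumes s: "0 < s" and D: "0 < D" and d: "0 \<le> d"
  shows "mass_cap s D d \<le> 99/100 * s"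
proof -
  define p where "p = 39/44 * s"
  define q where "q = 4875/3158 * s"
  have pq: "0 < p" "p < q" using s unfolding p_def q_def by auto
  have b0: "0 \<le> birth_share s D" unfolding birth_share_def using s D by auto
  have bD: "birth_share s D * D \<le> D" "birth_share s D * D \<le> 39/50 * s + 3/25 * D" "birth_share s D * D \<le> 97/100 * s"
  proof -
    have "birth_share s D \<le> 1" "birth_share s D \<le> 39/50 * s / D + 3/25" "birth_share s D \<le> 97/100 * s / D"
      unfolding birth_share_def by auto
    note m = mult_right_mono[OF this(1), of D] mult_right_mono[OF this(2), of D] mult_right_mono[OF this(3), of D]
    moreover have "(39/50 * s / D + 3/25) * D = 39/50 * s + 3/25 * D" "97/100 * s / D * D = 97/100 * s"
      using D by (auto simp: distrib_right)
    ultimately show "birth_share s D * D \<le> D" "birth_share s D * D \<le> 39/50 * s + 3/25 * D" "birth_share s D * D \<le> 97/100 * s"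
      using D m by linarith+
  qed
  have hmono: "primitive s (clip s d) \<le> primitive s q"
  proof -
    have c: "0 < clip s d" "clip s d \<le> q" unfolding clip_def p_def[symmetric] q_def[symmetric] using pq by auto
    have "39/50 * s / q - 1579/3125 = 0" unfolding q_def using s by simp
    with primitive_increment[OF s c] show ?thesis by (simp only: mult_zero_right)
  qed
  have main: "birth_share s D * D + forward_mass s d - forward_mass s D \<le> 99/100 * s"
  proof -
    consider "D < p" | "p \<le> D" "D < q" | "q \<le> D" by linarith
    then show ?thesis
    proof cases
      case 1
      have "forward_mass s D = D" using 1 pq unfolding forward_mass_def clip_def p_def[symmetric] q_def[symmetric] by auto
      moreover have "forward_mass s d \<le> primitive s q - primitive s p + p" using hmono unfolding forward_mass_def p_def by auto
      moreover have "39/50 * s + 3/25 * p = p" unfolding p_def by simp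
      moreover have "39/50 * s + 3/25 * p + primitive s q - primitive s p \<le> 99/100 * s"
        using mass_cap_middle[OF s, of p] pq unfolding p_def q_def by auto
      ultimately show ?thesis using bD by linarith
    next
      case 2
      have "forward_mass s D = primitive s D - primitive s p + p" using 2 pq unfolding forward_mass_def clip_def p_def[symmetric] q_def[symmetric] by auto
      moreover have "forward_mass s d \<le> primitive s q - primitive s p + p" using hmono unfolding forward_mass_def p_def by auto
      moreover have "39/50 * s + 3/25 * D + primitive s q - primitive s D \<le> 99/100 * s"
        using mass_cap_middle[OF s, of D] 2 unfolding p_def q_def by auto
      ultimately show ?thesis using bD by linarith
    next
      case 3
      have "forward_mass s D = primitive s q - primitive s p + p" using 3 pq unfolding forward_mass_def clip_def p_def[symmetric] q_def[symmetric] by auto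
      moreover have "forward_mass s d \<le> primitive s q - primitive s p + p" using hmono unfolding forward_mass_def p_def by auto
      ultimately show ?thesis using bD s by linarith
    qed
  qed
  show ?thesis
  proof (cases "d \<le> D")
    case True
    then have "birth_share s D * d \<le> birth_share s D * D" using b0 by (intro mult_left_mono) auto
    then show ?thesis using True bD s unfolding mass_cap_def by auto
  next
    case False
    then show ?thesis using main unfolding mass_cap_def by auto
  qed
qed

section \<open>The fractional colouring\<close>

text \<open>
  Histories are lists with the newest arrival first, so the vertex that arrives after \<open>g\<close> has
  number \<open>length g\<close>.
\<close>

primrec arrived_degree :: "nat set list \<Rightarrow> nat \<Rightarrow> nat" where
  "arrived_degree [] u = 0"
| "arrived_degree (N # g) u = arrived_degree g u + (if u \<in> N then 1 else 0) + (if u = length g then card N else 0)"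

definition dmax :: "nat \<Rightarrow> nat set list \<Rightarrow> nat" where
  "dmax d0 g = Max (insert d0 (arrived_degree g ` {..<length g}))"

text \<open>The edges of an arriving vertex are levelled against the loads before its arrival, and
  only those of the older endpoints; the newer endpoint just collects the resulting shares.\<close>

primrec load :: "nat \<Rightarrow> nat set list \<Rightarrow> nat \<Rightarrow> nat \<Rightarrow> real" where
  "load d0 [] u c = 0"
| "load d0 (N # g) u c = load d0 g u c
     + (if u \<in> N then level (load d0 g u) (dmax d0 (N # g)) c else 0)
     + (if u = length g then \<Sum>s\<in>N. level (load d0 g s) (dmax d0 (N # g)) c else 0)"

primrec hist_ok :: "nat set list \<Rightarrow> bool" where
  "hist_ok [] = True"
| "hist_ok (N # g) = (N \<subseteq> {..<length g} \<and> hist_ok g)"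

section \<open>Basic facts on degrees, loads and shares\<close>

lemma dmax_ge: "d0 \<le> dmax d0 g"
  unfolding dmax_def by (intro Max_ge) auto

lemma degree_le_dmax: "u < length g \<Longrightarrow> arrived_degree g u \<le> dmax d0 g"
  unfolding dmax_def by (intro Max_ge) auto

lemma dmax_mono: "dmax d0 g \<le> dmax d0 (N # g)"
proof -
  have "x \<le> dmax d0 (N # g)" if x: "x \<in> insert d0 (arrived_degree g ` {..<length g})" for x
  proof (cases "x = d0")
    case False
    then obtain u where u: "u < length g" "x = arrived_degree g u" using x False by blast
    then have "x \<le> arrived_degree (N # g) u" by simp
    also have "\<dots> \<le> dmax d0 (N # g)" using u by (intro degree_le_dmax) simp
    finally show ?thesis .
  qed (simp add: dmax_ge)
  then show ?thesis unfolding dmax_def[of d0 g] by (intro Max.boundedI) auto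
qed

lemma level_spread: "1000 \<le> D \<Longrightarrow> level L D \<in> spread D"
  using level[of D L] unfolding is_level_def by simp

lemma level_nonneg: "1000 \<le> D \<Longrightarrow> 0 \<le> level L D c"
  and level_le: "1000 \<le> D \<Longrightarrow> level L D c \<le> 97 / (100 * real D)"
  and level_outside: "1000 \<le> D \<Longrightarrow> ncol D \<le> c \<Longrightarrow> level L D c = 0"
  and sum_level: "1000 \<le> D \<Longrightarrow> (\<Sum>c<ncol D. level L D c) = 1"
  using level_spread[of D L] unfolding spread_def by auto

lemma level_support: "1000 \<le> D \<Longrightarrow> level L D c \<noteq> 0 \<Longrightarrow> c < ncol D"
  using level_outside[of D c L] by (cases "c < ncol D") auto

lemma degree_fresh: "hist_ok g \<Longrightarrow> length g \<le> u \<Longrightarrow> arrived_degree g u = 0"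
  by (induction g) auto

lemma load_fresh: "hist_ok g \<Longrightarrow> length g \<le> u \<Longrightarrow> load d0 g u c = 0"
  by (induction g) auto

lemma load_outside: "1000 \<le> d0 \<Longrightarrow> ncol (dmax d0 g) \<le> c \<Longrightarrow> load d0 g u c = 0"
proof (induction g)
  case (Cons N g)
  have "1000 \<le> dmax d0 (N # g)" using Cons.prems dmax_ge le_trans by blast
  moreover have "ncol (dmax d0 g) \<le> c"
    using Cons.prems ncol_mono[OF dmax_mono[of d0 g N]] by simp
  ultimately show ?case using Cons by (simp add: level_outside del: arrived_degree.simps)
qed simp

lemma sum_level_le_1:
  assumes "1000 \<le> D" "finite S"
  shows "sum (level L D) S \<le> 1"
proof -
  have "sum (level L D) S = sum (level L D) (S \<inter> {..<ncol D})"
    using assms level_support[of D L] by (intro sum.mono_neutral_right) auto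
  also have "\<dots> \<le> sum (level L D) {..<ncol D}"
    using assms level_nonneg[of D] by (intro sum_mono2) auto
  finally show ?thesis using sum_level[OF assms(1)] by simp
qed

text \<open>Follows from the caps and the total alone, for every \<open>S\<close>. It serves the
  newer endpoint, whose load does not influence the levelling.\<close>

lemma sum_level_le_birth_share:
  assumes D: "1000 \<le> D" and S: "finite S"
  shows "sum (level L D) S \<le> birth_share (card S) D"
proof -
  let ?x = "level L D"
  have "sum ?x S \<le> (\<Sum>c\<in>S. 97 / (100 * real D))"
    using D by (intro sum_mono level_le)
  then have a: "sum ?x S \<le> 97/100 * card S / D" by simp
  have exc: "(\<Sum>c<ncol D. max 0 (?x c - 39 / (50 * real D))) \<le> 3/25"
    using level_spread[OF D, of L] unfolding spread_def by auto
  have "sum ?x S = sum ?x (S \<inter> {..<ncol D})"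
    using assms level_support[of D L] by (intro sum.mono_neutral_right) auto
  also have "\<dots> \<le> (\<Sum>c\<in>S \<inter> {..<ncol D}. 39 / (50 * real D) + max 0 (?x c - 39 / (50 * real D)))"
    by (intro sum_mono) linarith
  also have "\<dots> = card (S \<inter> {..<ncol D}) * (39 / (50 * real D)) + (\<Sum>c\<in>S \<inter> {..<ncol D}. max 0 (?x c - 39 / (50 * real D)))"
    by (simp add: sum.distrib)
  also have "\<dots> \<le> card S * (39 / (50 * real D)) + (\<Sum>c<ncol D. max 0 (?x c - 39 / (50 * real D)))"
    using S by (intro add_mono mult_right_mono sum_mono2) (auto intro!: card_mono)
  finally have b: "sum ?x S \<le> 39/50 * card S / D + 3/25" using exc by simp
  show ?thesis using a b sum_level_le_1[OF D S, of L] unfolding birth_share_def by simp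
qed

text \<open>If \<open>S\<close> receives anything, the colours outside \<open>S\<close> are
  saturated, and there are at least \<open>1.776 * D - card S\<close> of them.\<close>

lemma sum_level_le_forward_share:
  assumes D: "1000 \<le> D" and S: "finite S"
    and sep: "\<And>c w. c \<in> S \<Longrightarrow> w \<in> {..<ncol D} - S \<Longrightarrow> L w + level L D w < L c + level L D c"
  shows "sum (level L D) S \<le> forward_share (card S) D"
proof (cases "real D < 39/44 * card S")
  case True
  then show ?thesis using sum_level_le_1[OF D S, of L] unfolding forward_share_def by simp
next
  case False
  let ?x = "level L D"
  have Dp: "0 < real D" using D by simp
  show ?thesis
  proof (cases "\<exists>c\<in>S. 0 < ?x c")
    case False
    then have "sum ?x S = 0" using level_nonneg[OF D, of L] by (intro sum.neutral) (metis order_le_less)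
    then show ?thesis unfolding forward_share_def by simp
  next
    case True
    then obtain c where c: "c \<in> S" "0 < ?x c" by auto
    define W where "W = {..<ncol D} - S"
    have sat: "min (97 / (100 * real D) * card W) (39 / (50 * real D) * card W + 3/25) \<le> sum ?x W"
      unfolding W_def using level_saturates[OF level[OF D] _ sep c] D by simp
    have "sum ?x (S \<inter> {..<ncol D}) + sum ?x W = sum ?x {..<ncol D}"
      unfolding W_def using S by (subst sum.union_disjoint[symmetric]) (auto intro!: sum.cong)
    moreover have "sum ?x S = sum ?x (S \<inter> {..<ncol D})"
      using assms level_support[of D L] by (intro sum.mono_neutral_right) auto
    ultimately have total_weight: "sum ?x S = 1 - sum ?x W" using sum_level[OF D, of L] by simp
    have "ncol D - card S \<le> card W" unfolding W_def using S diff_card_le_card_Diff[of S "{..<ncol D}"] by simp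
    then have "real (ncol D) - card S \<le> card W" by linarith
    then have w: "1.776 * real D - card S \<le> card W" using ncol_ge[OF D] by linarith
    define v where "v = (1.776 * real D - card S) / D"
    have v: "v \<le> card W / D" "v = 1.776 - card S / D"
      unfolding v_def using divide_right_mono[OF w, of D] Dp by (simp_all add: diff_divide_distrib)
    have "card S / D \<le> 44/39" using False Dp by (simp add: field_simps)
    \<comment> \<open>From \<open>v = 12/19\<close> on, hence from \<open>0.64\<close> on,
      \<open>39/50 * v + 3/25\<close> is at most \<open>97/100 * v\<close>, so the soft bound
      decides the minimum.\<close>
    then have v2: "0.64 \<le> v" using v by simp
    have "39/50 * v + 3/25 \<le> min (97/100 * (card W / D)) (39/50 * (card W / D) + 3/25)"
      using v v2 by auto
    also have "\<dots> = min (97 / (100 * real D) * card W) (39 / (50 * real D) * card W + 3/25)" by simp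
    finally have "sum ?x S \<le> 1 - (39/50 * v + 3/25)" using sat total_weight by linarith
    also have "\<dots> = 39/50 * (card S / D) - 1579/3125" 
      unfolding v(2) by (simp add: diff_divide_distrib right_diff_distrib)
    finally have "sum ?x S \<le> 39/50 * card S / D - 1579/3125" by simp
    then show ?thesis unfolding forward_share_def using False by simp
  qed
qed

text \<open>\<open>D0\<close> is the degree bound at the arrival of \<open>u\<close>. By
  \<open>level_order_preserving\<close>, a set of colours strictly above the others after an arrival
  was so before, which gives access to the induction hypothesis, while the forward bound handles the
  new edge.\<close>

lemma mass_bound:
  assumes "1000 \<le> d0" "hist_ok g" "u < length g" "finite S" "S \<noteq> {}"
    and "\<And>c w. c \<in> S \<Longrightarrow> w \<in> {..<ncol (dmax d0 g)} - S \<Longrightarrow> load d0 g u w < load d0 g u c"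
  shows "\<exists>D0::nat. 1000 \<le> D0 \<and> D0 \<le> dmax d0 g \<and> sum (load d0 g u) S \<le> mass_cap (card S) D0 (arrived_degree g u)"
  using assms(2,3,6)
proof (induction g)
  case (Cons N g)
  define D where "D = dmax d0 (N # g)"
  have D: "1000 \<le> D" unfolding D_def using assms(1) dmax_ge le_trans by blast
  have sigma: "0 < real (card S)" using assms(4,5) by (simp add: card_gt_0_iff)
  have N: "N \<subseteq> {..<length g}" "hist_ok g" using Cons.prems by auto
  then have fN: "finite N" using finite_subset by blast
  show ?case
  proof (cases "u = length g")
    case True
    then have uN: "u \<notin> N" using N by auto
    have dg: "arrived_degree (N # g) u = card N" using True uN degree_fresh[OF N(2), of u] by simp
    then have cN: "card N \<le> D" unfolding D_def using degree_le_dmax[of u "N # g" d0] True by simp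
    have "sum (load d0 (N # g) u) S = (\<Sum>c\<in>S. \<Sum>s\<in>N. level (load d0 g s) D c)"
      using True uN N load_fresh[of g u d0] unfolding D_def by simp
    also have "\<dots> = (\<Sum>s\<in>N. sum (level (load d0 g s) D) S)" by (rule sum.swap)
    also have "\<dots> \<le> (\<Sum>s\<in>N. birth_share (card S) D)"
      by (intro sum_mono sum_level_le_birth_share D assms)
    also have "\<dots> = mass_cap (card S) D (card N)" using cN unfolding mass_cap_def by simp
    finally show ?thesis using D dg unfolding D_def by auto
  next
    case False
    then have u: "u < length g" using Cons.prems by simp
    have pal: "ncol (dmax d0 g) \<le> ncol D" unfolding D_def by (intro ncol_mono dmax_mono)
    show ?thesis
    proof (cases "u \<in> N")
      case True
      let ?L = "load d0 g u"
      have new: "load d0 (N # g) u = (\<lambda>c. ?L c + level ?L D c)"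
        using True False unfolding D_def by (auto simp: fun_eq_iff)
      have sep: "?L w + level ?L D w < ?L c + level ?L D c" if "c \<in> S" "w \<in> {..<ncol D} - S" for c w
        using Cons.prems(3)[OF that[unfolded D_def]] new by simp
      have "?L w < ?L c" if "c \<in> S" "w \<in> {..<ncol (dmax d0 g)} - S" for c w
        using sep[of c w] level_order_preserving[OF level[OF D], of w ?L c] that pal by auto
      from Cons.IH[OF N(2) u this]
      obtain D0 where D0: "1000 \<le> D0" "D0 \<le> dmax d0 g" "sum ?L S \<le> mass_cap (card S) (real D0) (arrived_degree g u)"
        by auto
      have D0D: "D0 \<le> D" using D0(2) dmax_mono[of d0 g N] unfolding D_def by linarith
      have dg: "arrived_degree (N # g) u = arrived_degree g u + 1" using True False by simp
      then have dD: "arrived_degree g u + 1 \<le> D" using degree_le_dmax[of u "N # g" d0] u unfolding D_def by simp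
      have "sum (load d0 (N # g) u) S = sum ?L S + sum (level ?L D) S"
        unfolding new by (simp add: sum.distrib)
      also have "\<dots> \<le> mass_cap (card S) D0 (arrived_degree g u) + forward_share (card S) D"
        using D0(3) sum_level_le_forward_share[OF D assms(4) sep] by linarith
      also have "\<dots> \<le> mass_cap (card S) D0 (real (arrived_degree g u) + 1)"
        using sigma D0 D0D dD by (intro mass_cap_step) auto
      also have "real (arrived_degree g u) + 1 = real (arrived_degree (N # g) u)" unfolding dg by simp
      finally have "sum (load d0 (N # g) u) S \<le> mass_cap (card S) D0 (arrived_degree (N # g) u)" .
      then show ?thesis using D0 D0D unfolding D_def by auto
    next
      case uN: False
      have new: "load d0 (N # g) u = load d0 g u" "arrived_degree (N # g) u = arrived_degree g u"
        using uN False by (auto simp: fun_eq_iff)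
      have "load d0 g u w < load d0 g u c" if "c \<in> S" "w \<in> {..<ncol (dmax d0 g)} - S" for c w
        using Cons.prems(3)[of c w] pal that unfolding new D_def by auto
      from Cons.IH[OF N(2) u this] obtain D0 where "1000 \<le> D0" "D0 \<le> dmax d0 g"
          "sum (load d0 g u) S \<le> mass_cap (card S) (real D0) (arrived_degree g u)"
        by auto
      then show ?thesis unfolding new using dmax_mono[of d0 g N] by (meson le_trans)
    qed
  qed
qed simp

text \<open>On the set \<open>S\<close> of colours with maximal load, the mass is
  \<open>card S\<close> times the maximum, so a bound on the mass bounds the maximum.\<close>

theorem load_le:
  assumes "1000 \<le> d0" "hist_ok g"
  shows "load d0 g u c \<le> 99/100"
proof (cases "u < length g \<and> c < ncol (dmax d0 g)")
  case True
  define C where "C = {..<ncol (dmax d0 g)}"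
  define th where "th = Max (load d0 g u ` C)"
  define S where "S = {c\<in>C. load d0 g u c = th}"
  have C: "finite C" "C \<noteq> {}" "c \<in> C" unfolding C_def using True by auto
  have "th \<in> load d0 g u ` C" unfolding th_def using C by (intro Max_in) auto
  then have S: "finite S" "S \<noteq> {}" unfolding S_def using C by auto
  have le: "load d0 g u w \<le> th" if "w \<in> C" for w unfolding th_def using C that by (intro Max_ge) auto
  have "load d0 g u w < load d0 g u k" if "k \<in> S" "w \<in> C - S" for k w
    using that le[of w] unfolding S_def by auto
  from mass_bound[OF assms _ S this[unfolded C_def]] True
  obtain D0 :: nat where D0: "1000 \<le> D0" "sum (load d0 g u) S \<le> mass_cap (card S) D0 (arrived_degree g u)" by auto
  have cS: "0 < real (card S)" using S by (simp add: card_gt_0_iff)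
  have "card S * th = sum (load d0 g u) S" unfolding S_def by simp
  also have "\<dots> \<le> card S * (99/100)" using D0 mass_cap_le[OF cS, of D0 "arrived_degree g u"] by simp
  finally have "th \<le> 99/100" using cS by simp
  then show ?thesis using le[OF C(3)] by linarith
next
  case False
  then show ?thesis using load_fresh[OF assms(2), of u d0 c] load_outside[OF assms(1), of g c u]
    by (cases "u < length g") auto
qed

section \<open>Rounding\<close>

text \<open>
  An edge is recorded as its newer endpoint, its older endpoint and its shares. A history of
  coloured edges has the newest edge first.
\<close>

type_synonym edge_rec = "nat \<times> nat \<times> (nat \<Rightarrow> real)"
type_synonym color_hist = "(edge_rec \<times> nat) list"

definition ends :: "edge_rec \<Rightarrow> nat set" where
  "ends e = {fst e, fst (snd e)}"

definition weight :: "(nat \<Rightarrow> nat \<Rightarrow> real) \<Rightarrow> edge_rec \<Rightarrow> nat \<Rightarrow> real" where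
  "weight \<Phi> e c = snd (snd e) c * \<Phi> (fst e) c * \<Phi> (fst (snd e)) c"

definition total_weight :: "nat \<Rightarrow> (nat \<Rightarrow> nat \<Rightarrow> real) \<Rightarrow> edge_rec \<Rightarrow> real" where
  "total_weight C \<Phi> e = (\<Sum>c<C. weight \<Phi> e c)"

definition color_prob :: "nat \<Rightarrow> (nat \<Rightarrow> nat \<Rightarrow> real) \<Rightarrow> edge_rec \<Rightarrow> nat \<Rightarrow> real" where
  "color_prob C \<Phi> e c = weight \<Phi> e c / total_weight C \<Phi> e"

primrec phi :: "nat \<Rightarrow> color_hist \<Rightarrow> nat \<Rightarrow> nat \<Rightarrow> real" where
  "phi C [] = (\<lambda>v c. 1)"
| "phi C (ek # r) = (\<lambda>v c. if v \<in> ends (fst ek)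
     then if c = snd ek then 0 else phi C r v c / (1 - color_prob C (phi C r) (fst ek) c)
     else phi C r v c)"

text \<open>Invalid weights fall back to colour \<open>0\<close>, which makes the definition total.
  The next edge after a history that is \<open>good\<close> and \<open>ok\<close> never needs
  this.\<close>

definition color_pmf :: "nat \<Rightarrow> (nat \<Rightarrow> nat \<Rightarrow> real) \<Rightarrow> edge_rec \<Rightarrow> nat pmf" where
  "color_pmf C \<Phi> e = (if (\<forall>c<C. 0 \<le> weight \<Phi> e c) \<and> 0 < total_weight C \<Phi> e
     then embed_pmf (\<lambda>c. if c < C then color_prob C \<Phi> e c else 0) else return_pmf 0)"

primrec color_process :: "nat \<Rightarrow> edge_rec list \<Rightarrow> color_hist \<Rightarrow> color_hist pmf" where
  "color_process C [] r = return_pmf r"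
| "color_process C (e # es) r = bind_pmf (color_pmf C (phi C r) e) (\<lambda>k. color_process C es ((e, k) # r))"

section \<open>Tools for drawing colours and for exponential moments\<close>

lemma pmf_color_pmf:
  assumes "\<And>c. c < C \<Longrightarrow> 0 \<le> weight \<Phi> e c" "0 < total_weight C \<Phi> e"
  shows "pmf (color_pmf C \<Phi> e) k = (if k < C then color_prob C \<Phi> e k else 0)"
proof -
  let ?f = "\<lambda>c. if c < C then color_prob C \<Phi> e c else 0"
  have qn: "0 \<le> color_prob C \<Phi> e c" if "c < C" for c using assms that unfolding color_prob_def by simp
  then have nn: "0 \<le> ?f c" for c by simp
  have "(\<integral>\<^sup>+ c. ennreal (?f c) \<partial>count_space UNIV) = (\<Sum>c<C. ennreal (?f c))"
    by (rule nn_integral_count_space'[where A = "{..<C}"]) auto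
  also have "\<dots> = ennreal (\<Sum>c<C. color_prob C \<Phi> e c)"
    using qn by (subst sum_ennreal[symmetric]) auto
  also have "(\<Sum>c<C. color_prob C \<Phi> e c) = 1"
    using assms(2) unfolding color_prob_def by (simp add: sum_divide_distrib[symmetric] total_weight_def)
  finally show ?thesis
    using assms nn unfolding color_pmf_def by (simp add: pmf_embed_pmf)
qed

lemma set_color_pmf_less: "0 < C \<Longrightarrow> set_pmf (color_pmf C \<Phi> e) \<subseteq> {..<C}"
proof
  fix k
  assume C: "0 < C" and k: "k \<in> set_pmf (color_pmf C \<Phi> e)"
  show "k \<in> {..<C}"
  proof (cases "(\<forall>c<C. 0 \<le> weight \<Phi> e c) \<and> 0 < total_weight C \<Phi> e")
    case True
    then have "pmf (color_pmf C \<Phi> e) k = (if k < C then color_prob C \<Phi> e k else 0)"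
      by (intro pmf_color_pmf) auto
    then show ?thesis using k by (auto simp: set_pmf_iff split: if_splits)
  next
    case False
    then have "color_pmf C \<Phi> e = return_pmf 0" unfolding color_pmf_def by auto
    then show ?thesis using k C by simp
  qed
qed

lemma exp_le_quadratic:
  fixes y :: real
  assumes "\<bar>y\<bar> \<le> 1"
  shows "exp y \<le> 1 + y + y\<^sup>2"
proof (cases "0 \<le> y")
  case True
  then show ?thesis using exp_bound[of y] assms by simp
next
  case False
  define z where "z = - y"
  have z: "0 < z" "z \<le> 1" using False assms unfolding z_def by auto
  have "exp y = 1 / exp z" unfolding z_def by (simp add: exp_minus inverse_eq_divide)
  also have "\<dots> \<le> 1 / (1 + z)" using z exp_ge_add_one_self[of z] by (intro divide_left_mono) auto
  also have "\<dots> \<le> 1 - z + z\<^sup>2"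
  proof -
    have "1 \<le> (1 - z + z\<^sup>2) * (1 + z)" using z by (simp add: algebra_simps power2_eq_square)
    then show ?thesis using z by (simp add: field_simps)
  qed
  finally show ?thesis unfolding z_def by simp
qed

text \<open>The exponential moment of a centred bounded variable is controlled by its variance, as
  in Freedman's inequality.\<close>

lemma centered_exp_bound:
  fixes p X :: "'a \<Rightarrow> real"
  assumes "\<And>k. k \<in> A \<Longrightarrow> 0 \<le> p k" "sum p A = 1"
    and "(\<Sum>k\<in>A. p k * X k) = 0" and "\<And>k. k \<in> A \<Longrightarrow> \<bar>X k\<bar> \<le> 1"
  shows "(\<Sum>k\<in>A. p k * exp (X k)) \<le> exp (\<Sum>k\<in>A. p k * (X k)\<^sup>2)"
proof -
  have "(\<Sum>k\<in>A. p k * exp (X k)) \<le> (\<Sum>k\<in>A. p k * (1 + X k + (X k)\<^sup>2))"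
    using assms by (intro sum_mono mult_left_mono exp_le_quadratic) auto
  also have "\<dots> = 1 + (\<Sum>k\<in>A. p k * (X k)\<^sup>2)"
    using assms by (simp add: distrib_left sum.distrib)
  also have "\<dots> \<le> exp (\<Sum>k\<in>A. p k * (X k)\<^sup>2)" by (rule exp_ge_add_one_self)
  finally show ?thesis .
qed

lemma prob_bind_pmf_finite:
  assumes "finite A" "set_pmf M \<subseteq> A"
  shows "measure_pmf.prob (bind_pmf M N) E = (\<Sum>k\<in>A. pmf M k * measure_pmf.prob (N k) E)"
proof -
  have "measure_pmf.prob (bind_pmf M N) E = (\<integral>k. measure_pmf.prob (N k) E \<partial>measure_pmf M)"
  proof -
    have "ennreal (measure_pmf.prob (bind_pmf M N) E) = emeasure (measure_pmf (bind_pmf M N)) E"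
      by (rule measure_pmf.emeasure_eq_measure[symmetric])
    also have "\<dots> = (\<integral>\<^sup>+k. emeasure (N k) E \<partial>measure_pmf M)" by (rule emeasure_bind_pmf)
    also have "\<dots> = (\<integral>\<^sup>+k. ennreal (measure_pmf.prob (N k) E) \<partial>measure_pmf M)"
      by (simp only: measure_pmf.emeasure_eq_measure)
    also have "\<dots> = ennreal (\<integral>k. measure_pmf.prob (N k) E \<partial>measure_pmf M)"
      by (intro nn_integral_eq_integral measure_pmf.integrable_const_bound[where B = 1]) auto
    finally show ?thesis by (simp add: integral_nonneg_AE)
  qed
  also have "\<dots> = (\<Sum>k\<in>A. measure_pmf.prob (N k) E * pmf M k)"
    using assms by (intro integral_measure_pmf_real) auto
  finally show ?thesis by (simp add: mult.commute)
qed

text \<open>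
  The predictable variation of \<open>phi\<close>, up to a factor that is bounded by \<open>phi\<close> itself. It stays
  bounded because every increment is at most the growth of \<open>phi\<close>.
\<close>

primrec spent :: "nat \<Rightarrow> color_hist \<Rightarrow> nat \<Rightarrow> nat \<Rightarrow> real" where
  "spent C [] v c = 0"
| "spent C (ek # r) v c = spent C r v c + (if v \<in> ends (fst ek) then color_prob C (phi C r) (fst ek) c * phi C r v c else 0)"

lemma phi_used: "(e, k) \<in> set r \<Longrightarrow> v \<in> ends e \<Longrightarrow> phi C r v k = 0"
  by (induction r) auto

text \<open>Interface to the fractional part: \<open>dat\<close> lists the edges in the order of
  colouring, and \<open>dd i\<close> is the degree bound when edge \<open>i\<close> arrives. The
  number \<open>400000\<close> ensures \<open>400 * 400 / d0 \<le> 1/2 * (499/500)\<close>, so that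
  no colour has probability above \<open>1/2\<close>. Assumption \<open>touch\<close> limits how
  many steps disturb the normalisation of edge \<open>i\<close>.\<close>

locale rounding =
  fixes dat :: "edge_rec list" and C nv :: nat and dd :: "nat \<Rightarrow> real" and d0 :: real
  assumes d0: "400000 \<le> d0"
    and dd: "\<And>i. i < length dat \<Longrightarrow> d0 \<le> dd i"
    and ends_less: "\<And>i. i < length dat \<Longrightarrow> ends (dat ! i) \<subseteq> {..<nv}"
    and ends_ne: "\<And>i. i < length dat \<Longrightarrow> fst (dat ! i) \<noteq> fst (snd (dat ! i))"
    and ends_inj: "inj_on (\<lambda>i. ends (dat ! i)) {..<length dat}"
    and x_nonneg: "\<And>i c. i < length dat \<Longrightarrow> 0 \<le> snd (snd (dat ! i)) c"
    and x_le: "\<And>i c. i < length dat \<Longrightarrow> snd (snd (dat ! i)) c \<le> 1 / dd i"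
    and x_sum: "\<And>i. i < length dat \<Longrightarrow> (\<Sum>c<C. snd (snd (dat ! i)) c) = 1"
    and x_load: "\<And>u c. u < nv \<Longrightarrow> c < C \<Longrightarrow>
      (\<Sum>i | i < length dat \<and> u \<in> ends (dat ! i). snd (snd (dat ! i)) c) \<le> 99/100"
    and touch: "\<And>i. i < length dat \<Longrightarrow>
      real (card {l. l < i \<and> ends (dat ! l) \<inter> ends (dat ! i) \<noteq> {}}) \<le> 2 * dd i"
begin

definition x :: "nat \<Rightarrow> nat \<Rightarrow> real" where "x i = snd (snd (dat ! i))"

definition inc :: "nat \<Rightarrow> nat set" where "inc u = {i. i < length dat \<and> u \<in> ends (dat ! i)}"

definition oth :: "nat \<Rightarrow> nat \<Rightarrow> nat" where
  "oth u i = (if fst (dat ! i) = u then fst (snd (dat ! i)) else fst (dat ! i))"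

text \<open>
  The value of \<open>phi\<close> is frozen when edge number \<open>i\<close> is coloured, so that \<open>Y\<close> and \<open>Z\<close> below are
  martingales for all time; for later edges the truncated subtraction gives the current value.
\<close>

definition frz :: "color_hist \<Rightarrow> nat \<Rightarrow> nat \<Rightarrow> nat \<Rightarrow> real" where
  "frz r i = phi C (drop (length r - i) r)"

definition Y :: "color_hist \<Rightarrow> nat \<Rightarrow> nat \<Rightarrow> real" where
  "Y r u c = (\<Sum>i\<in>inc u. x i c * frz r i (oth u i) c)"

definition Z :: "color_hist \<Rightarrow> nat \<Rightarrow> real" where
  "Z r i = total_weight C (frz r i) (dat ! i)"

text \<open>At the start every \<open>Z\<close> is \<open>1\<close> and every \<open>Y\<close> is at
  most \<open>99/100\<close>, so \<open>ok\<close> allows deviations by \<open>1/500\<close> and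
  \<open>1/200\<close>.\<close>

definition ok :: "color_hist \<Rightarrow> bool" where
  "ok r \<longleftrightarrow> (\<forall>i<length dat. \<bar>Z r i - 1\<bar> \<le> 1/500) \<and> (\<forall>u<nv. \<forall>c<C. Y r u c \<le> 199/200)"

text \<open>\<open>ok\<close> is demanded of the proper suffixes only: it held whenever a colour was
  drawn, but the last draw may have destroyed it.\<close>

primrec good :: "color_hist \<Rightarrow> bool" where
  "good [] = True"
| "good (ek # r) = (good r \<and> ok r \<and> length r < length dat \<and> fst ek = dat ! length r \<and>
     snd ek < C \<and> 0 < color_prob C (phi C r) (fst ek) (snd ek))"

section \<open>Control of \<open>phi\<close> along good histories\<close>

lemma good_drop: "good r \<Longrightarrow> good (drop n r)"
proof (induction r arbitrary: n)
  case (Cons ek r)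
  then show ?case by (cases n) auto
qed simp

lemma good_fst: "good r \<Longrightarrow> length r \<le> length dat \<and> map fst r = rev (take (length r) dat)"
  by (induction r) (auto simp: take_Suc_conv_app_nth)

lemma finite_inc [simp]: "finite (inc u)"
  unfolding inc_def by simp

lemma ends_oth: "u \<in> ends (dat ! i) \<Longrightarrow> ends (dat ! i) = {u, oth u i}"
  unfolding ends_def oth_def by auto

lemma oth_less: "i \<in> inc u \<Longrightarrow> oth u i < nv"
  using ends_less[of i] ends_oth[of u i] unfolding inc_def by auto

lemma frz_Cons: "frz (ek # r) i = (if i \<le> length r then frz r i else phi C (ek # r))"
  unfolding frz_def by (auto simp: Suc_diff_le)

lemma frz_ge: "length r \<le> i \<Longrightarrow> frz r i = phi C r"
  unfolding frz_def by simp

lemma x_facts: "i < length dat \<Longrightarrow> 0 \<le> x i c" "i < length dat \<Longrightarrow> x i c \<le> 1 / dd i"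
  "i < length dat \<Longrightarrow> x i c \<le> 1 / d0"
proof -
  show "i < length dat \<Longrightarrow> 0 \<le> x i c" "i < length dat \<Longrightarrow> x i c \<le> 1 / dd i"
    using x_nonneg x_le unfolding x_def by auto
  then show "i < length dat \<Longrightarrow> x i c \<le> 1 / d0"
    using dd[of i] d0 frac_le[of 1 1 d0 "dd i"] by fastforce
qed

lemma weight_eq: "weight \<Phi> (dat ! i) c = x i c * \<Phi> (fst (dat ! i)) c * \<Phi> (fst (snd (dat ! i))) c"
  unfolding weight_def x_def by simp

lemma weight_oth: "u \<in> ends (dat ! i) \<Longrightarrow> weight \<Phi> (dat ! i) c = x i c * \<Phi> u c * \<Phi> (oth u i) c"
  unfolding weight_eq oth_def ends_def by auto

text \<open>
  As long as the colour \<open>c\<close> is free at \<open>u\<close>, the reciprocal of \<open>phi\<close> decreases at every edge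
  of \<open>u\<close> exactly by the summand of \<open>Y\<close> for this edge, up to normalisation. Hence a bound on
  \<open>Y\<close> is a bound on \<open>phi\<close>.
\<close>

definition inv_ok :: "color_hist \<Rightarrow> bool" where
  "inv_ok r \<longleftrightarrow> (\<forall>u<nv. \<forall>c<C. phi C r u c = 0 \<or> (0 < phi C r u c \<and>
     1 - 500/499 * (\<Sum>i\<in>inc u \<inter> {..<length r}. x i c * frz r i (oth u i) c) \<le> 1 / phi C r u c))"

lemma phi_bounds_of_inv:
  assumes r: "good r" "ok r" and inv: "\<And>n. inv_ok (drop n r)" and u: "u < nv" "c < C"
  shows "0 \<le> phi C r u c" "phi C r u c \<le> 400"
proof -
  have nn: "0 \<le> phi C (drop n r) v c" if "v < nv" for v n
    using inv[of n] u that unfolding inv_ok_def by fastforce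
  have I: "phi C r u c = 0 \<or> (0 < phi C r u c \<and>
     1 - 500/499 * (\<Sum>i\<in>inc u \<inter> {..<length r}. x i c * frz r i (oth u i) c) \<le> 1 / phi C r u c)"
    using inv[of 0] u unfolding inv_ok_def by auto
  then show "0 \<le> phi C r u c" by auto
  have "(\<Sum>i\<in>inc u \<inter> {..<length r}. x i c * frz r i (oth u i) c) \<le> Y r u c"
    unfolding Y_def using nn oth_less x_facts
    by (intro sum_mono2) (auto simp: frz_def inc_def intro!: mult_nonneg_nonneg)
  also have "\<dots> \<le> 199/200" using r u unfolding ok_def by auto
  \<comment> \<open>\<open>1 - 500/499 * (199/200)\<close> is about \<open>0.003\<close>, hence
    above \<open>1/400\<close>.\<close>
  finally have "1/400 \<le> 1 / phi C r u c \<or> phi C r u c = 0" using I by linarith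
  moreover have "phi C r u c \<le> 400" if "1/400 \<le> 1 / phi C r u c" "0 < phi C r u c"
    using that by (simp add: field_simps)
  ultimately show "phi C r u c \<le> 400" using I by auto
qed

text \<open>Stated relative to bounds on \<open>phi\<close>, so that it is available inside the
  induction that proves them.\<close>

lemma color_prob_facts_of_phi:
  assumes r: "good r" "ok r" and j: "length r < length dat"
    and phi: "\<And>u c. u < nv \<Longrightarrow> c < C \<Longrightarrow> 0 \<le> phi C r u c \<and> phi C r u c \<le> 400"
  shows "499/500 \<le> total_weight C (phi C r) (dat ! length r)"
    and "c < C \<Longrightarrow> 0 \<le> weight (phi C r) (dat ! length r) c"
    and "c < C \<Longrightarrow> 0 \<le> color_prob C (phi C r) (dat ! length r) c"
    and "c < C \<Longrightarrow> color_prob C (phi C r) (dat ! length r) c \<le> 1/2"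
proof -
  let ?j = "length r"
  have "\<bar>total_weight C (phi C r) (dat ! ?j) - 1\<bar> \<le> 1/500"
    using r j unfolding ok_def Z_def by (metis frz_ge order_refl)
  then show t: "499/500 \<le> total_weight C (phi C r) (dat ! ?j)" by linarith
  have e: "fst (dat ! ?j) < nv" "fst (snd (dat ! ?j)) < nv"
    using ends_less[OF j] unfolding ends_def by auto
  show w0: "c < C \<Longrightarrow> 0 \<le> weight (phi C r) (dat ! ?j) c"
    unfolding weight_eq using phi e x_facts[OF j] by auto
  then show "c < C \<Longrightarrow> 0 \<le> color_prob C (phi C r) (dat ! ?j) c" unfolding color_prob_def using t by auto
  assume c: "c < C"
  have "weight (phi C r) (dat ! ?j) c \<le> 1 / d0 * 400 * 400"
    unfolding weight_eq using phi e x_facts[OF j, of c] c d0 by (intro mult_mono) auto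
  also have "\<dots> \<le> 1/2 * (499/500)" using d0 by (simp add: field_simps)
  finally have "weight (phi C r) (dat ! ?j) c \<le> 1/2 * total_weight C (phi C r) (dat ! ?j)" using t by linarith
  then show "color_prob C (phi C r) (dat ! ?j) c \<le> 1/2" unfolding color_prob_def using t by (simp add: field_simps)
qed

lemma inv: "good r \<Longrightarrow> inv_ok r"
proof (induction r rule: length_induct)
  case (1 r)
  show ?case
  proof (cases r)
    case Nil
    then show ?thesis unfolding inv_ok_def by simp
  next
    case (Cons ek s)
    have g: "good s" "ok s" and j: "length s < length dat" "fst ek = dat ! length s"
      using 1(2) Cons by auto
    have all: "inv_ok (drop n s)" for n
      using 1(1) good_drop[OF g(1), of n] Cons by simp
    note ph = phi_bounds_of_inv[OF g all]
    note qf = color_prob_facts_of_phi[OF g j(1) conjI[OF ph]]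
    have "phi C r u c = 0 \<or> (0 < phi C r u c \<and>
       1 - 500/499 * (\<Sum>i\<in>inc u \<inter> {..<length r}. x i c * frz r i (oth u i) c) \<le> 1 / phi C r u c)"
      if u: "u < nv" "c < C" for u c
    proof -
      have Is: "phi C s u c = 0 \<or> (0 < phi C s u c \<and>
         1 - 500/499 * (\<Sum>i\<in>inc u \<inter> {..<length s}. x i c * frz s i (oth u i) c) \<le> 1 / phi C s u c)"
        using all[of 0] u unfolding inv_ok_def by auto
      have sm: "(\<Sum>i\<in>inc u \<inter> {..<length s}. x i c * frz r i (oth u i) c) =
          (\<Sum>i\<in>inc u \<inter> {..<length s}. x i c * frz s i (oth u i) c)"
        unfolding Cons by (intro sum.cong) (auto simp: frz_Cons)
      show ?thesis
      proof (cases "u \<in> ends (dat ! length s)")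
        case False
        then have "inc u \<inter> {..<length r} = inc u \<inter> {..<length s}"
          unfolding Cons inc_def by (auto simp: less_Suc_eq)
        moreover have "phi C r u c = phi C s u c" using False j unfolding Cons by simp
        ultimately show ?thesis using Is sm by simp
      next
        case True
        then have "inc u \<inter> {..<length r} = insert (length s) (inc u \<inter> {..<length s})"
          unfolding Cons inc_def using j by auto
        then have sr: "(\<Sum>i\<in>inc u \<inter> {..<length r}. x i c * frz r i (oth u i) c) =
            x (length s) c * phi C s (oth u (length s)) c + (\<Sum>i\<in>inc u \<inter> {..<length s}. x i c * frz s i (oth u i) c)"
          using sm unfolding Cons by (simp add: frz_Cons frz_ge)
        define q where "q = color_prob C (phi C s) (dat ! length s) c"
        have q: "0 \<le> q" "q \<le> 1/2" using qf u unfolding q_def by auto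
        show ?thesis
        proof (cases "c = snd ek \<or> phi C s u c = 0")
          case True
          then have "phi C r u c = 0" using \<open>u \<in> ends (dat ! length s)\<close> j unfolding Cons by auto
          then show ?thesis by simp
        next
          case c: False
          have pr: "phi C r u c = phi C s u c / (1 - q)" using True c j unfolding Cons q_def by simp
          have ps: "0 < phi C s u c" using c ph[OF u] by auto
          have o: "0 \<le> x (length s) c * phi C s (oth u (length s)) c"
            using ph(1)[of "oth u (length s)" c] u oth_less[of "length s" u] True j x_facts
            unfolding inc_def by auto
          have "q / phi C s u c = x (length s) c * phi C s (oth u (length s)) c / total_weight C (phi C s) (dat ! length s)"
            unfolding q_def color_prob_def weight_oth[OF True] using ps by simp
          also have "\<dots> \<le> x (length s) c * phi C s (oth u (length s)) c / (499/500)"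
            using o qf(1) by (intro divide_left_mono) auto
          finally have "q / phi C s u c \<le> 500/499 * (x (length s) c * phi C s (oth u (length s)) c)" by simp
          moreover have "1 / phi C r u c = 1 / phi C s u c - q / phi C s u c"
            unfolding pr by (simp add: diff_divide_distrib)
          ultimately have "1 - 500/499 * (\<Sum>i\<in>inc u \<inter> {..<length r}. x i c * frz r i (oth u i) c) \<le> 1 / phi C r u c"
            using Is c unfolding sr distrib_left by linarith
          moreover have "0 < phi C r u c" unfolding pr using ps q by simp
          ultimately show ?thesis by simp
        qed
      qed
    qed
    then show ?thesis unfolding inv_ok_def by blast
  qed
qed

lemma phi_bounds:
  assumes "good r" "ok r" "u < nv" "c < C"
  shows "0 \<le> phi C r u c" "phi C r u c \<le> 400"
  using phi_bounds_of_inv[OF assms(1,2) inv[OF good_drop] assms(3,4)] assms(1) by auto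

lemma color_prob_facts:
  assumes r: "good r" "ok r" and j: "length r < length dat"
  shows "499/500 \<le> total_weight C (phi C r) (dat ! length r)"
    and "c < C \<Longrightarrow> 0 \<le> weight (phi C r) (dat ! length r) c"
    and "c < C \<Longrightarrow> 0 \<le> color_prob C (phi C r) (dat ! length r) c"
    and "c < C \<Longrightarrow> color_prob C (phi C r) (dat ! length r) c \<le> 1/2"
    and "(\<Sum>c<C. color_prob C (phi C r) (dat ! length r) c) = 1"
proof -
  note qf = color_prob_facts_of_phi[OF assms conjI[OF phi_bounds[OF r]]]
  show "499/500 \<le> total_weight C (phi C r) (dat ! length r)"
    "c < C \<Longrightarrow> 0 \<le> weight (phi C r) (dat ! length r) c"
    "c < C \<Longrightarrow> 0 \<le> color_prob C (phi C r) (dat ! length r) c"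
    "c < C \<Longrightarrow> color_prob C (phi C r) (dat ! length r) c \<le> 1/2"
    using qf by auto
  then show "(\<Sum>c<C. color_prob C (phi C r) (dat ! length r) c) = 1"
    unfolding color_prob_def by (simp add: sum_divide_distrib[symmetric] total_weight_def[symmetric])
qed

text \<open>While \<open>c\<close> is free at \<open>v\<close>, \<open>phi\<close> grows at least as
  fast as \<open>spent\<close>, by \<open>1 + q \<le> 1 / (1 - q)\<close>. When \<open>c\<close> is
  used, \<open>spent\<close> is at most \<open>400 + 200\<close>, and it stays constant afterwards
  because \<open>phi\<close> is \<open>0\<close>.\<close>

lemma spent_bound:
  assumes "good r" "v < nv" "c < C"
  shows "0 \<le> spent C r v c \<and> (phi C r v c = 0 \<and> spent C r v c \<le> 800 \<or> spent C r v c \<le> phi C r v c)"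
  using assms
proof (induction r)
  case (Cons ek r)
  then have g: "good r" "ok r" and j: "length r < length dat" "fst ek = dat ! length r" by auto
  define q where "q = color_prob C (phi C r) (fst ek) c"
  have q: "0 \<le> q" "q \<le> 1/2" using color_prob_facts[OF g j(1)] Cons.prems j unfolding q_def by auto
  have p: "0 \<le> phi C r v c" "phi C r v c \<le> 400" using phi_bounds[OF g] Cons.prems by auto
  have qp: "0 \<le> q * phi C r v c" "q * phi C r v c \<le> 1/2 * 400"
    using mult_mono[of q "1/2" "phi C r v c" 400] q p by auto
  have IH: "0 \<le> spent C r v c" "phi C r v c = 0 \<and> spent C r v c \<le> 800 \<or> spent C r v c \<le> phi C r v c"
    using Cons by auto
  have "phi C r v c + q * phi C r v c \<le> phi C r v c / (1 - q)"
  proof -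
    have "(1 + q) * (1 - q) \<le> 1" by (simp add: algebra_simps)
    then have "1 + q \<le> 1 / (1 - q)" using q by (simp add: field_simps)
    then have "phi C r v c * (1 + q) \<le> phi C r v c * (1 / (1 - q))" using p by (intro mult_left_mono) auto
    then show ?thesis by (simp add: algebra_simps)
  qed
  then show ?case using IH p qp unfolding spent.simps phi.simps q_def[symmetric] by auto
qed simp

text \<open>Since \<open>good r\<close> does not include \<open>ok r\<close>, there is no bound on
  \<open>phi\<close> for \<open>r\<close> itself; the last step is estimated from the
  suffix.\<close>

lemma spent_le:
  assumes "good r" "v < nv" "c < C"
  shows "spent C r v c \<le> 800"
proof (cases r)
  case (Cons ek s)
  then have g: "good s" "ok s" and j: "length s < length dat" "fst ek = dat ! length s" using assms by auto
  define q where "q = color_prob C (phi C s) (fst ek) c"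
  have q: "0 \<le> q" "q \<le> 1/2" using color_prob_facts[OF g j(1)] assms j unfolding q_def by auto
  have p: "0 \<le> phi C s v c" "phi C s v c \<le> 400" using phi_bounds[OF g] assms by auto
  have "q * phi C s v c \<le> 1/2 * 400" using mult_mono[of q "1/2" "phi C s v c" 400] q p by auto
  then show ?thesis using spent_bound[OF g(1) assms(2,3)] p unfolding Cons spent.simps q_def[symmetric] by auto
qed simp

end

text \<open>Both scales make the linear gains \<open>tau / 200\<close> and
  \<open>sigma / 500\<close> exceed the quadratic variance terms by at least
  \<open>1 / 10^18\<close>.\<close>

definition tau :: real where "tau = 1 / 10^9"
definition sigma :: real where "sigma = 1 / 10^15"

lemma exp_mult_left_mono: "a \<le> b \<Longrightarrow> 0 \<le> d \<Longrightarrow> exp (d * a) \<le> exp (d * b :: real)"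
  by (simp add: mult_left_mono)

section \<open>Exponential supermartingales and the failure probability\<close>

context rounding
begin

definition compensator :: "color_hist \<Rightarrow> nat \<Rightarrow> nat \<Rightarrow> real" where
  "compensator r u c = (\<Sum>i\<in>inc u. x i c * spent C r (oth u i) c)"

text \<open>\<open>1280000 = 1600 * 800\<close> covers the largest possible compensator term, so
  \<open>WY\<close> is at least \<open>1\<close> as soon as \<open>Y\<close> exceeds its
  limit.\<close>

definition WY :: "color_hist \<Rightarrow> nat \<Rightarrow> nat \<Rightarrow> real" where
  "WY r u c = exp (d0 * (tau * (Y r u c - 199/200) + 1280000 * tau\<^sup>2 - 1600 * tau\<^sup>2 * compensator r u c))"

definition touched :: "color_hist \<Rightarrow> nat \<Rightarrow> real" where
  "touched r i = real (card {l. l < i \<and> l < length r \<and> ends (dat ! l) \<inter> ends (dat ! i) \<noteq> {}})"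

text \<open>The exponent holds a variance reserve for the edges touching edge \<open>i\<close> that
  are still to come, at most \<open>2 * dd i\<close> in all. The factor
  \<open>320000 = 2 * 400\<^sup>2\<close> comes from the bounds \<open>400\<close> on
  \<open>phi\<close> and \<open>1/2\<close> on probabilities. The signs \<open>1\<close> and
  \<open>-1\<close> of \<open>s\<close> give the two tails.\<close>

definition WZ :: "real \<Rightarrow> color_hist \<Rightarrow> nat \<Rightarrow> real" where
  "WZ s r i = exp (d0 * sigma * (s * (Z r i - 1) - 1/500) + (d0 * sigma * 320000 / dd i)\<^sup>2 * (2 * dd i - touched r i))"

text \<open>One potential for all bad events: it does not grow on average and is at least
  \<open>1\<close> at a failure, so its initial value is a union bound.\<close>

definition Psi :: "color_hist \<Rightarrow> real" where
  "Psi r = (\<Sum>u<nv. \<Sum>c<C. WY r u c) + (\<Sum>i<length dat. WZ 1 r i + WZ (-1) r i)"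

lemma compensator_le:
  assumes "good r" "u < nv" "c < C"
  shows "compensator r u c \<le> 800"
proof -
  have "compensator r u c \<le> (\<Sum>i\<in>inc u. x i c * 800)"
    unfolding compensator_def using assms oth_less x_facts spent_le
    by (intro sum_mono mult_left_mono) (auto simp: inc_def)
  also have "\<dots> = 800 * (\<Sum>i\<in>inc u. x i c)"
    unfolding sum_distrib_left by (intro sum.cong) auto
  also have "\<dots> \<le> 800 * (99/100)"
    using x_load[of u c] assms unfolding inc_def x_def by simp
  finally show ?thesis by simp
qed

lemma WY_bad: "good r \<Longrightarrow> u < nv \<Longrightarrow> c < C \<Longrightarrow> 199/200 < Y r u c \<Longrightarrow> 1 \<le> WY r u c"
proof -
  assume a: "good r" "u < nv" "c < C" "199/200 < Y r u c"
  have "1600 * tau\<^sup>2 * compensator r u c \<le> 1600 * tau\<^sup>2 * 800"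
    using compensator_le[OF a(1-3)] by (intro mult_left_mono) auto
  moreover have "0 \<le> tau * (Y r u c - 199/200)" using a unfolding tau_def by simp
  ultimately show ?thesis unfolding WY_def using d0 by simp
qed

lemma touched_le: "i < length dat \<Longrightarrow> touched r i \<le> 2 * dd i"
proof -
  assume i: "i < length dat"
  have "touched r i \<le> real (card {l. l < i \<and> ends (dat ! l) \<inter> ends (dat ! i) \<noteq> {}})"
    unfolding touched_def by (intro of_nat_mono card_mono) auto
  then show ?thesis using touch[OF i] by linarith
qed

lemma WZ_bad: "i < length dat \<Longrightarrow> 1/500 < s * (Z r i - 1) \<Longrightarrow> 1 \<le> WZ s r i"
  unfolding WZ_def using touched_le[of i r] d0 by (auto simp: sigma_def intro!: add_nonneg_nonneg mult_nonneg_nonneg)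

lemma WY_pos: "0 \<le> WY r u c" and WZ_pos: "0 \<le> WZ s r i"
  unfolding WY_def WZ_def by auto

lemma Psi_nonneg: "0 \<le> Psi r"
  unfolding Psi_def by (intro add_nonneg_nonneg sum_nonneg WY_pos WZ_pos)

lemma Psi_bad:
  assumes "good r" "\<not> ok r"
  shows "1 \<le> Psi r"
proof -
  consider (Z) i where "i < length dat" "1/500 < \<bar>Z r i - 1\<bar>"
    | (Y) u c where "u < nv" "c < C" "199/200 < Y r u c"
    using assms(2) unfolding ok_def by (auto simp: not_le)
  then show ?thesis
  proof cases
    case Z
    then have "1/500 < 1 * (Z r i - 1) \<or> 1/500 < (- 1) * (Z r i - 1)"
      by (auto simp: abs_if split: if_splits)
    then have "1 \<le> WZ 1 r i \<or> 1 \<le> WZ (-1) r i"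
      using WZ_bad[OF Z(1), of 1 r] WZ_bad[OF Z(1), of "- 1" r] by blast
    then have "1 \<le> WZ 1 r i + WZ (-1) r i" using WZ_pos[of 1 r i] WZ_pos[of "-1" r i] by linarith
    also have "\<dots> \<le> (\<Sum>i<length dat. WZ 1 r i + WZ (-1) r i)"
      using Z(1) WZ_pos by (intro member_le_sum) (auto intro: add_nonneg_nonneg)
    finally have "1 \<le> (\<Sum>i<length dat. WZ 1 r i + WZ (-1) r i)" .
    moreover have "0 \<le> (\<Sum>u<nv. \<Sum>c<C. WY r u c)" by (intro sum_nonneg WY_pos)
    ultimately show ?thesis unfolding Psi_def by linarith
  next
    case Y
    then have "1 \<le> WY r u c" using WY_bad assms by blast
    also have "\<dots> \<le> (\<Sum>c<C. WY r u c)" using Y WY_pos by (intro member_le_sum) auto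
    also have "\<dots> \<le> (\<Sum>u<nv. \<Sum>c<C. WY r u c)"
      using Y WY_pos by (intro member_le_sum[of u _ "\<lambda>u. \<Sum>c<C. WY r u c"]) (auto intro: sum_nonneg)
    finally have "1 \<le> (\<Sum>u<nv. \<Sum>c<C. WY r u c)" .
    moreover have "0 \<le> (\<Sum>i<length dat. WZ 1 r i + WZ (-1) r i)" by (intro sum_nonneg add_nonneg_nonneg WZ_pos)
    ultimately show ?thesis unfolding Psi_def by linarith
  qed
qed

text \<open>Only an edge that touches the later edge \<open>i\<close> matters. Then the increment
  \<open>X\<close> of the exponent has mean \<open>0\<close> and size at most \<open>h\<close>, and
  the resulting factor \<open>exp (h\<^sup>2)\<close> is paid by the increase of
  \<open>touched\<close>.\<close>

lemma WZ_step:
  assumes r: "good r" "ok r" and j: "length r < length dat" and i: "i < length dat" and s: "\<bar>s\<bar> = 1"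
  shows "(\<Sum>k<C. color_prob C (phi C r) (dat ! length r) k * WZ s ((dat ! length r, k) # r) i) \<le> WZ s r i"
proof -
  define j where "j = length r"
  define q where "q = color_prob C (phi C r) (dat ! j)"
  define r' where "r' k = (dat ! j, k) # r" for k
  note qf = color_prob_facts[OF r j, folded j_def, folded q_def]
  have jl: "j < length dat" using j j_def by simp
  have ddi: "0 < dd i" using dd[OF i] d0 by simp
  define h where "h = d0 * sigma * 320000 / dd i"
  have h: "0 \<le> h" "h \<le> 1"
  proof -
    show "0 \<le> h" unfolding h_def sigma_def using d0 ddi by simp
    have "d0 * sigma * 320000 \<le> dd i * 1" using dd[OF i] d0 unfolding sigma_def by simp
    then show "h \<le> 1" unfolding h_def using ddi by (simp add: field_simps)
  qed
  have avg: "(\<Sum>k<C. q k * w) = w" for w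
    using qf(5) by (simp add: sum_distrib_right[symmetric])
  show ?thesis
  proof (cases "j < i \<and> ends (dat ! j) \<inter> ends (dat ! i) \<noteq> {}")
    case False
    have "Z (r' k) i = Z r i" for k
    proof (cases "i \<le> j")
      case True
      then show ?thesis unfolding Z_def r'_def frz_Cons j_def by simp
    next
      case ij: False
      then have disj: "ends (dat ! j) \<inter> ends (dat ! i) = {}" using False by auto
      have "fst (dat ! i) \<notin> ends (dat ! j)" "fst (snd (dat ! i)) \<notin> ends (dat ! j)"
        using disj unfolding ends_def[of "dat ! i"] by auto
      then have "weight (phi C (r' k)) (dat ! i) c = weight (phi C r) (dat ! i) c" for c
        unfolding weight_eq r'_def by simp
      then show ?thesis using ij unfolding Z_def r'_def frz_Cons total_weight_def
        using frz_ge[of r i] j_def by simp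
    qed
    moreover have "touched r i \<le> touched (r' k) i" for k
      unfolding touched_def r'_def by (intro of_nat_mono card_mono) auto
    ultimately have "WZ s (r' k) i \<le> WZ s r i" for k
      unfolding WZ_def by (auto intro!: mult_left_mono)
    then have "(\<Sum>k<C. q k * WZ s (r' k) i) \<le> (\<Sum>k<C. q k * WZ s r i)"
      using qf(3) by (intro sum_mono mult_left_mono) auto
    then show ?thesis unfolding avg unfolding q_def r'_def j_def .
  next
    case True
    then have ji: "j < i" by simp
    obtain v where v: "v \<in> ends (dat ! j)" "v \<in> ends (dat ! i)" using True by auto
    define w where "w = oth v i"
    \<comment> \<open>Two distinct edges share at most one endpoint, so only one of the two factors
      \<open>phi\<close> in the weights of edge \<open>i\<close> changes.\<close>
    have wj: "w \<notin> ends (dat ! j)"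
    proof
      assume "w \<in> ends (dat ! j)"
      moreover have "v \<noteq> w" using ends_ne[OF i] v(2) unfolding w_def oth_def ends_def by auto
      ultimately have "oth v j = w" using ends_oth[OF v(1)] by auto
      then have "ends (dat ! j) = ends (dat ! i)" using ends_oth[OF v(1)] ends_oth[OF v(2)] w_def by simp
      then show False using inj_onD[OF ends_inj, of j i] jl i ji by auto
    qed
    have vw: "v < nv" "w < nv" using ends_less[OF i] v ends_oth[OF v(2)] unfolding w_def by auto
    define g where "g c = x i c * phi C r v c * phi C r w c" for c
    have g: "0 \<le> g c" "g c \<le> 160000 / dd i" if "c < C" for c
    proof -
      show "0 \<le> g c" unfolding g_def using phi_bounds[OF r] vw that x_facts[OF i] by auto
      have "g c \<le> 1 / dd i * 400 * 400" unfolding g_def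
        using phi_bounds[OF r] vw that x_facts[OF i] ddi by (intro mult_mono) auto
      then show "g c \<le> 160000 / dd i" by simp
    qed
    \<comment> \<open>\<open>S\<close> is the total gain from the divisions by
      \<open>1 - q c\<close>; it equals the mean of the loss \<open>g k / (1 - q k)\<close> at the
      drawn colour.\<close>
    define S where "S = (\<Sum>c<C. g c * q c / (1 - q c))"
    have Zr: "Z r i = (\<Sum>c<C. g c)"
      unfolding Z_def total_weight_def g_def w_def using frz_ge[of r i] ji j_def weight_oth[OF v(2)] by simp
    have Zr': "Z (r' k) i = Z r i + (S - g k / (1 - q k))" if k: "k < C" for k
    proof -
      have "weight (phi C (r' k)) (dat ! i) c = g c / (1 - q c) - (if c = k then g k / (1 - q k) else 0)" for c
        unfolding weight_oth[OF v(2)] g_def w_def[symmetric] r'_def q_def using v(1) wj by auto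
      then have "Z (r' k) i = (\<Sum>c<C. g c / (1 - q c) - (if c = k then g k / (1 - q k) else 0))"
        unfolding Z_def total_weight_def r'_def frz_Cons using ji j_def by simp
      also have "\<dots> = (\<Sum>c<C. g c / (1 - q c)) - g k / (1 - q k)"
        using k by (simp add: sum_subtractf)
      also have "(\<Sum>c<C. g c / (1 - q c)) = (\<Sum>c<C. g c + g c * q c / (1 - q c))"
      proof (intro sum.cong refl)
        fix c assume "c \<in> {..<C}"
        then have "0 < 1 - q c" using qf(4)[of c] by auto
        then show "g c / (1 - q c) = g c + g c * q c / (1 - q c)" by (simp add: field_simps)
      qed
      finally show ?thesis unfolding Zr S_def by (simp add: sum.distrib)
    qed
    have half: "0 \<le> g k / (1 - q k) \<and> g k / (1 - q k) \<le> 320000 / dd i" if "k < C" for k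
    proof -
      have "g k / (1 - q k) \<le> g k / (1/2)"
        using g[OF that] qf(4)[OF that] by (intro divide_left_mono) auto
      also have "\<dots> \<le> 320000 / dd i" using g[OF that] by simp
      finally show ?thesis using g[OF that] qf(4)[OF that] by simp
    qed
    have S2: "S = (\<Sum>k<C. q k * (g k / (1 - q k)))" unfolding S_def by (simp add: mult.commute)
    have S: "0 \<le> S" "S \<le> 320000 / dd i"
    proof -
      show "0 \<le> S" unfolding S2 using qf(3) half by (intro sum_nonneg mult_nonneg_nonneg) auto
      have "S \<le> (\<Sum>k<C. q k * (320000 / dd i))" unfolding S2
        using qf(3) half by (intro sum_mono mult_left_mono) auto
      then show "S \<le> 320000 / dd i" unfolding avg .
    qed
    define X where "X k = d0 * sigma * s * (S - g k / (1 - q k))" for k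
    have Xb: "\<bar>X k\<bar> \<le> h" if "k < C" for k
    proof -
      have "\<bar>S - g k / (1 - q k)\<bar> \<le> 320000 / dd i" using S half[OF that] by linarith
      then have "d0 * sigma * \<bar>S - g k / (1 - q k)\<bar> \<le> d0 * sigma * (320000 / dd i)"
        using d0 unfolding sigma_def by (intro mult_left_mono) auto
      then show ?thesis unfolding X_def h_def abs_mult using d0 s unfolding sigma_def by simp
    qed
    have "(\<Sum>k<C. q k * X k) = d0 * sigma * s * (\<Sum>k<C. q k * (S - g k / (1 - q k)))"
      unfolding X_def by (simp add: sum_distrib_left mult_ac)
    also have "(\<Sum>k<C. q k * (S - g k / (1 - q k))) = (\<Sum>k<C. q k * S) - S"
      unfolding S2 by (simp add: right_diff_distrib sum_subtractf)
    finally have mean: "(\<Sum>k<C. q k * X k) = 0" unfolding avg by simp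
    have "(\<Sum>k<C. q k * exp (X k)) \<le> exp (\<Sum>k<C. q k * (X k)\<^sup>2)"
      using qf(3,5) mean Xb h by (intro centered_exp_bound) (auto intro: order_trans)
    also have "(\<Sum>k<C. q k * (X k)\<^sup>2) \<le> (\<Sum>k<C. q k * h\<^sup>2)"
      using qf(3) Xb h by (intro sum_mono mult_left_mono) (auto intro: abs_le_square_iff[THEN iffD1] simp: abs_le_square_iff[symmetric])
    finally have E: "(\<Sum>k<C. q k * exp (X k)) \<le> exp (h\<^sup>2)" unfolding avg by simp
    have cn: "touched (r' k) i = touched r i + 1" for k
    proof -
      have "{l. l < i \<and> l < length (r' k) \<and> ends (dat ! l) \<inter> ends (dat ! i) \<noteq> {}} =
          insert j {l. l < i \<and> l < length r \<and> ends (dat ! l) \<inter> ends (dat ! i) \<noteq> {}}"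
        using True unfolding r'_def j_def by auto
      then show ?thesis unfolding touched_def j_def by simp
    qed
    have "WZ s (r' k) i = WZ s r i * exp (- (h\<^sup>2)) * exp (X k)" if "k < C" for k
      unfolding WZ_def cn Zr'[OF that] h_def[symmetric] X_def
      by (simp add: exp_add[symmetric] algebra_simps)
    then have "(\<Sum>k<C. q k * WZ s (r' k) i) = WZ s r i * exp (- (h\<^sup>2)) * (\<Sum>k<C. q k * exp (X k))"
      by (simp add: sum_distrib_left mult_ac)
    also have "\<dots> \<le> WZ s r i * exp (- (h\<^sup>2)) * exp (h\<^sup>2)"
      using E WZ_pos by (intro mult_left_mono) auto
    also have "\<dots> = WZ s r i" by (simp add: exp_minus)
    finally show ?thesis unfolding q_def r'_def j_def .
  qed
qed

text \<open>At an edge of \<open>u\<close> itself \<open>Y\<close> does not change. Otherwise it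
  takes two values, falling by \<open>B\<close> if \<open>c\<close> is drawn and rising by
  \<open>B * (q c / (1 - q c))\<close> if not; the variance is paid by the growth of
  \<open>compensator\<close>.\<close>

lemma WY_step:
  assumes r: "good r" "ok r" and j: "length r < length dat" and u: "u < nv" "c < C"
  shows "(\<Sum>k<C. color_prob C (phi C r) (dat ! length r) k * WY ((dat ! length r, k) # r) u c) \<le> WY r u c"
proof -
  define j where "j = length r"
  define q where "q = color_prob C (phi C r) (dat ! j)"
  define r' where "r' k = (dat ! j, k) # r" for k
  note qf = color_prob_facts[OF r j, folded j_def, folded q_def]
  have jl: "j < length dat" using j j_def by simp
  have avg: "(\<Sum>k<C. q k * w) = w" for w
    using qf(5) by (simp add: sum_distrib_right[symmetric])
  have ph: "0 \<le> phi C r (oth u i) c" "phi C r (oth u i) c \<le> 400" if "i \<in> inc u" for i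
    using phi_bounds[OF r oth_less[OF that] u(2)] by auto
  have xi: "0 \<le> x i c" "x i c \<le> 1 / d0" if "i \<in> inc u" for i
    using x_facts[of i c] that unfolding inc_def by auto
  have rr': "spent C (r' k) v c = spent C r v c + (if v \<in> ends (dat ! j) then q c * phi C r v c else 0)" for k v
    unfolding r'_def q_def by simp
  show ?thesis
  proof (cases "u \<in> ends (dat ! j)")
    case True
    have o: "oth u i \<notin> ends (dat ! j)" if "i \<in> inc u" "j < i" for i
    proof
      assume a: "oth u i \<in> ends (dat ! j)"
      have i: "i < length dat" "u \<in> ends (dat ! i)" using that unfolding inc_def by auto
      have "u \<noteq> oth u i" using ends_ne[OF i(1)] i(2) unfolding oth_def ends_def by auto
      then have "ends (dat ! j) = ends (dat ! i)" using a ends_oth[OF True] ends_oth[OF i(2)] by auto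
      then show False using inj_onD[OF ends_inj, of j i] jl i that by auto
    qed
    have "frz (r' k) i (oth u i) c = frz r i (oth u i) c" if "i \<in> inc u" for i k
    proof (cases "i \<le> j")
      case False
      then show ?thesis using o[OF that] unfolding r'_def frz_Cons using frz_ge[of r i] j_def by simp
    qed (simp add: r'_def frz_Cons j_def)
    then have "Y (r' k) u c = Y r u c" for k unfolding Y_def by (intro sum.cong) auto
    moreover have "compensator r u c \<le> compensator (r' k) u c" for k
      unfolding compensator_def rr' using xi ph qf(3)[OF u(2)] by (intro sum_mono mult_left_mono) auto
    ultimately have "WY (r' k) u c \<le> WY r u c" for k
      unfolding WY_def using d0 by (intro exp_mult_left_mono) (auto intro!: mult_left_mono)
    then have "(\<Sum>k<C. q k * WY (r' k) u c) \<le> (\<Sum>k<C. q k * WY r u c)"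
      using qf(3) by (intro sum_mono mult_left_mono) auto
    then show ?thesis unfolding avg unfolding q_def r'_def j_def .
  next
    case False
    \<comment> \<open>These are the later edges of \<open>u\<close> whose other endpoint is
      affected; there are at most two, one for each endpoint of edge \<open>j\<close>.\<close>
    define J where "J = {i\<in>inc u. j < i \<and> oth u i \<in> ends (dat ! j)}"
    define B where "B = (\<Sum>i\<in>J. x i c * phi C r (oth u i) c)"
    have J: "J \<subseteq> inc u" "finite J" unfolding J_def by auto
    have "inj_on (oth u) J"
    proof (rule inj_onI)
      fix i i' assume a: "i \<in> J" "i' \<in> J" "oth u i = oth u i'"
      then have i: "i < length dat" "u \<in> ends (dat ! i)" "i' < length dat" "u \<in> ends (dat ! i')"
        unfolding J_def inc_def by auto
      then have "ends (dat ! i) = ends (dat ! i')" using a(3) ends_oth[OF i(2)] ends_oth[OF i(4)] by simp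
      then show "i = i'" using inj_onD[OF ends_inj, of i i'] i by auto
    qed
    moreover have "oth u ` J \<subseteq> ends (dat ! j)" unfolding J_def by auto
    ultimately have "card J \<le> card (ends (dat ! j))"
      by (intro card_inj_on_le) (auto simp: ends_def)
    also have "\<dots> \<le> 2" unfolding ends_def by (auto simp: card_insert_if)
    finally have cJ: "card J \<le> 2" .
    have B0: "0 \<le> B" unfolding B_def using xi ph J by (intro sum_nonneg mult_nonneg_nonneg) auto
    have "B \<le> (\<Sum>i\<in>J. 1 / d0 * 400)" unfolding B_def
      using xi ph J d0 by (intro sum_mono mult_mono) auto
    also have "\<dots> = card J * (400 / d0)" by simp
    also have "\<dots> \<le> 2 * (400 / d0)" using cJ d0 by (intro mult_right_mono) auto
    finally have B: "d0 * B \<le> 800" using d0 by (simp add: field_simps)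
    define y where "y = d0 * tau * B"
    have y: "0 \<le> y" "y \<le> 1" unfolding y_def tau_def using B0 B d0 by auto
    have q: "0 \<le> q c" "q c \<le> 1/2" using qf u by auto
    have Yr': "Y (r' k) u c = Y r u c + (if k = c then - B else B * (q c / (1 - q c)))" for k
    proof -
      have t: "x i c * frz (r' k) i (oth u i) c = x i c * frz r i (oth u i) c
        + (if i \<in> J then (x i c * phi C r (oth u i) c) * (if k = c then - 1 else q c / (1 - q c)) else 0)"
        if "i \<in> inc u" for i
      proof (cases "i \<le> j")
        case True
        then show ?thesis unfolding J_def r'_def frz_Cons j_def by simp
      next
        case ij: False
        have f: "frz r i = phi C r" "frz (r' k) i = phi C (r' k)"
          using ij frz_ge[of r i] unfolding r'_def frz_Cons j_def by auto
        show ?thesis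
        proof (cases "oth u i \<in> ends (dat ! j)")
          case True
          then have "i \<in> J" using ij that unfolding J_def by auto
          moreover have "phi C (r' k) (oth u i) c = (if c = k then 0 else phi C r (oth u i) c / (1 - q c))"
            unfolding r'_def q_def using True by simp
          moreover have "phi C r (oth u i) c / (1 - q c) = phi C r (oth u i) c + phi C r (oth u i) c * (q c / (1 - q c))"
            using q by (simp add: field_simps)
          ultimately show ?thesis unfolding f by (auto simp: algebra_simps)
        next
          case no: False
          then have "i \<notin> J" "phi C (r' k) (oth u i) c = phi C r (oth u i) c"
            unfolding J_def r'_def by auto
          then show ?thesis unfolding f by simp
        qed
      qed
      have "Y (r' k) u c = Y r u c + (\<Sum>i\<in>inc u. if i \<in> J then (x i c * phi C r (oth u i) c) * (if k = c then - 1 else q c / (1 - q c)) else 0)"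
        unfolding Y_def using t by (simp add: sum.distrib)
      also have "(\<Sum>i\<in>inc u. if i \<in> J then (x i c * phi C r (oth u i) c) * (if k = c then - 1 else q c / (1 - q c)) else 0)
          = (\<Sum>i\<in>J. (x i c * phi C r (oth u i) c) * (if k = c then - 1 else q c / (1 - q c)))"
        using J by (simp add: sum.If_cases Int_absorb1 inf.absorb2)
      also have "\<dots> = B * (if k = c then - 1 else q c / (1 - q c))"
        unfolding B_def by (simp add: sum_distrib_right)
      finally show ?thesis by auto
    qed
    have cr': "compensator r u c + q c * B \<le> compensator (r' k) u c" for k
    proof -
      have "compensator r u c + q c * B = compensator r u c + (\<Sum>i\<in>inc u. if i \<in> J then x i c * (q c * phi C r (oth u i) c) else 0)"
        unfolding B_def using J by (simp add: sum.If_cases Int_absorb1 inf.absorb2 sum_distrib_left mult_ac)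
      also have "\<dots> \<le> compensator (r' k) u c"
        unfolding compensator_def sum.distrib[symmetric] rr'
      proof (intro sum_mono)
        fix i assume i: "i \<in> inc u"
        have "0 \<le> x i c * (q c * phi C r (oth u i) c)" using xi[OF i] ph[OF i] q by simp
        then show "x i c * spent C r (oth u i) c + (if i \<in> J then x i c * (q c * phi C r (oth u i) c) else 0)
          \<le> x i c * (spent C r (oth u i) c + (if oth u i \<in> ends (dat ! j) then q c * phi C r (oth u i) c else 0))"
          unfolding J_def by (auto simp: distrib_left)
      qed
      finally show ?thesis .
    qed
    define X where "X k = (if k = c then - y else y * (q c / (1 - q c)))" for k
    have two: "(\<Sum>k<C. q k * f (k = c)) = q c * f True + (1 - q c) * f False" for f :: "bool \<Rightarrow> real"
    proof -
      have "(\<Sum>k<C. q k * f (k = c)) = q c * f True + (\<Sum>k\<in>{..<C} - {c}. q k * f (k = c))"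
        using u by (subst sum.remove[of _ c]) auto
      also have "(\<Sum>k\<in>{..<C} - {c}. q k * f (k = c)) = (\<Sum>k\<in>{..<C} - {c}. q k) * f False"
        unfolding sum_distrib_right by (intro sum.cong) auto
      also have "(\<Sum>k\<in>{..<C} - {c}. q k) = 1 - q c"
        using qf(5) u by (simp add: sum_diff1)
      finally show ?thesis .
    qed
    have ratio: "0 \<le> q c / (1 - q c)" "q c / (1 - q c) \<le> 1" using q by auto
    have "(\<Sum>k<C. q k * X k) = q c * (- y) + (1 - q c) * (y * (q c / (1 - q c)))"
      unfolding X_def using two[of "\<lambda>b. if b then - y else y * (q c / (1 - q c))"] by simp
    also have "\<dots> = 0" using q by simp
    finally have mean: "(\<Sum>k<C. q k * X k) = 0" .
    have z: "0 \<le> y * (q c / (1 - q c))" "y * (q c / (1 - q c)) \<le> 1"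
      using mult_mono[of y 1 "q c / (1 - q c)" 1] mult_nonneg_nonneg[OF y(1) ratio(1)] y ratio by auto
    have Xb: "\<bar>X k\<bar> \<le> 1" for k
      unfolding X_def abs_if using y z by (cases "k = c") (simp_all del: times_divide_eq_right)
    have "(\<Sum>k<C. q k * (X k)\<^sup>2) = q c * y\<^sup>2 + (1 - q c) * (y * (q c / (1 - q c)))\<^sup>2"
      unfolding X_def using two[of "\<lambda>b. (if b then - y else y * (q c / (1 - q c)))\<^sup>2"] by simp
    also have "(1 - q c) * (y * (q c / (1 - q c)))\<^sup>2 = q c * y\<^sup>2 * (q c / (1 - q c))"
    proof -
      have "d * (y * (q c / d))\<^sup>2 = q c * y\<^sup>2 * (q c / d)" if "0 < d" for d
        using that by (simp add: power2_eq_square)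
      from this[of "1 - q c"] show ?thesis using q by simp
    qed
    also have "\<dots> \<le> q c * y\<^sup>2 * 1" using ratio q by (intro mult_left_mono) auto
    finally have "(\<Sum>k<C. q k * (X k)\<^sup>2) \<le> 2 * q c * y\<^sup>2" by simp
    \<comment> \<open>Replacing one factor \<open>d0 * B\<close> by \<open>800\<close> makes the
      variance linear in \<open>B\<close>, matching the compensator; hence
      \<open>1600 = 2 * 800\<close>.\<close>
    also have "\<dots> = 2 * d0 * tau\<^sup>2 * (q c * B) * (d0 * B)" unfolding y_def by (simp add: power2_eq_square mult_ac)
    also have "\<dots> \<le> 2 * d0 * tau\<^sup>2 * (q c * B) * 800"
      using B q B0 d0 by (intro mult_left_mono) auto
    finally have var: "(\<Sum>k<C. q k * (X k)\<^sup>2) \<le> d0 * (1600 * tau\<^sup>2 * (q c * B))" by simp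
    have "(\<Sum>k<C. q k * exp (X k)) \<le> exp (\<Sum>k<C. q k * (X k)\<^sup>2)"
      using qf(3,5) mean Xb by (intro centered_exp_bound) auto
    also have "\<dots> \<le> exp (d0 * (1600 * tau\<^sup>2 * (q c * B)))" using var by simp
    finally have E: "(\<Sum>k<C. q k * exp (X k)) \<le> exp (d0 * (1600 * tau\<^sup>2 * (q c * B)))" .
    define F where "F = d0 * (1600 * tau\<^sup>2 * (q c * B))"
    have "WY (r' k) u c \<le> WY r u c * exp (- F) * exp (X k)" for k
    proof -
      have X: "X k = d0 * (tau * (if k = c then - B else B * (q c / (1 - q c))))"
        unfolding X_def y_def by simp
      have "1600 * tau\<^sup>2 * (compensator r u c + q c * B) \<le> 1600 * tau\<^sup>2 * compensator (r' k) u c"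
        using cr' by (intro mult_left_mono) auto
      then have "WY (r' k) u c \<le> exp (d0 * (tau * (Y (r' k) u c - 199/200) + 1280000 * tau\<^sup>2 - 1600 * tau\<^sup>2 * (compensator r u c + q c * B)))"
        unfolding WY_def using d0 by (intro exp_mult_left_mono) auto
      also have "\<dots> = WY r u c * exp (- F) * exp (X k)"
        unfolding WY_def Yr' X F_def exp_add[symmetric] by (simp add: algebra_simps)
      finally show ?thesis .
    qed
    then have "(\<Sum>k<C. q k * WY (r' k) u c) \<le> (\<Sum>k<C. q k * (WY r u c * exp (- F) * exp (X k)))"
      using qf(3) by (intro sum_mono mult_left_mono) auto
    also have "\<dots> = WY r u c * exp (- F) * (\<Sum>k<C. q k * exp (X k))"
      by (simp add: sum_distrib_left mult_ac)
    also have "\<dots> \<le> WY r u c * exp (- F) * exp F"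
      using E WY_pos unfolding F_def by (intro mult_left_mono) auto
    also have "\<dots> = WY r u c" by (simp add: exp_minus)
    finally show ?thesis unfolding q_def r'_def j_def .
  qed
qed

lemma Psi_step:
  assumes r: "good r" "ok r" and j: "length r < length dat"
  shows "(\<Sum>k<C. color_prob C (phi C r) (dat ! length r) k * Psi ((dat ! length r, k) # r)) \<le> Psi r"
proof -
  let ?q = "color_prob C (phi C r) (dat ! length r)"
  let ?r = "\<lambda>k. (dat ! length r, k) # r"
  have "(\<Sum>k<C. ?q k * Psi (?r k)) = (\<Sum>u<nv. \<Sum>c<C. \<Sum>k<C. ?q k * WY (?r k) u c)
      + (\<Sum>i<length dat. (\<Sum>k<C. ?q k * WZ 1 (?r k) i) + (\<Sum>k<C. ?q k * WZ (-1) (?r k) i))"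
  proof -
    have "(\<Sum>k<C. ?q k * (\<Sum>u<nv. \<Sum>c<C. WY (?r k) u c)) = (\<Sum>u<nv. \<Sum>k<C. \<Sum>c<C. ?q k * WY (?r k) u c)"
      by (simp only: sum_distrib_left) (rule sum.swap)
    also have "\<dots> = (\<Sum>u<nv. \<Sum>c<C. \<Sum>k<C. ?q k * WY (?r k) u c)"
      by (intro sum.cong refl sum.swap)
    finally have a: "(\<Sum>k<C. ?q k * (\<Sum>u<nv. \<Sum>c<C. WY (?r k) u c)) = \<dots>" .
    have "(\<Sum>k<C. ?q k * (\<Sum>i<length dat. WZ 1 (?r k) i + WZ (-1) (?r k) i)) =
       (\<Sum>i<length dat. \<Sum>k<C. ?q k * (WZ 1 (?r k) i + WZ (-1) (?r k) i))"
      by (simp only: sum_distrib_left) (rule sum.swap)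
    also have "\<dots> = (\<Sum>i<length dat. (\<Sum>k<C. ?q k * WZ 1 (?r k) i) + (\<Sum>k<C. ?q k * WZ (-1) (?r k) i))"
      by (simp add: distrib_left sum.distrib)
    finally show ?thesis unfolding Psi_def distrib_left sum.distrib a by simp
  qed
  also have "\<dots> \<le> Psi r" unfolding Psi_def
    by (intro add_mono sum_mono WY_step WZ_step assms) auto
  finally show ?thesis .
qed

lemma Psi_Nil: "Psi [] \<le> (real nv * real C + 2 * real (length dat)) * exp (- d0 / 10^18)"
proof -
  have Y: "WY [] u c \<le> exp (- d0 / 10^18)" if "u < nv" "c < C" for u c
  proof -
    have "Y [] u c \<le> 99/100"
      using x_load[OF that] unfolding Y_def frz_def inc_def x_def by simp
    then have "tau * (Y [] u c - 199/200) \<le> tau * (- (1/200))"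
      unfolding tau_def by (intro mult_left_mono) auto
    moreover have "tau * (- (1/200)) + 1280000 * tau\<^sup>2 \<le> - (1 / 10^18)"
      unfolding tau_def by (simp add: power2_eq_square)
    moreover have "compensator [] u c = 0" unfolding compensator_def by simp
    ultimately have "tau * (Y [] u c - 199/200) + 1280000 * tau\<^sup>2 - 1600 * tau\<^sup>2 * compensator [] u c \<le> - (1 / 10^18)"
      by simp
    then have "WY [] u c \<le> exp (d0 * - (1 / 10^18))"
      unfolding WY_def using d0 by (intro exp_mult_left_mono) auto
    then show ?thesis by simp
  qed
  have Z: "WZ s [] i \<le> exp (- d0 / 10^18)" if i: "i < length dat" for s i
  proof -
    have "Z [] i = 1"
      using x_sum[OF i] unfolding Z_def total_weight_def frz_def weight_eq x_def by simp
    moreover have "touched [] i = 0" unfolding touched_def by simp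
    \<comment> \<open>\<open>204800000000 = 2 * 320000\<^sup>2\<close> is the full reserve, and one
      factor \<open>d0 / dd i \<le> 1\<close> is dropped.\<close>
    moreover have "(d0 * sigma * 320000 / dd i)\<^sup>2 * (2 * dd i) \<le> d0 * (sigma\<^sup>2 * 204800000000)"
    proof -
      have p: "0 < dd i" "d0 / dd i \<le> 1" using dd[OF i] d0 by auto
      have "(d0 * sigma * 320000 / dd i)\<^sup>2 * (2 * dd i) = d0 * (sigma\<^sup>2 * 204800000000) * (d0 / dd i)"
        using p by (simp add: power2_eq_square)
      also have "\<dots> \<le> d0 * (sigma\<^sup>2 * 204800000000) * 1"
        using p d0 by (intro mult_left_mono) auto
      finally show ?thesis by simp
    qed
    moreover have "d0 * sigma * (- (1/500)) + d0 * (sigma\<^sup>2 * 204800000000) \<le> d0 * - (1 / 10^18)"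
    proof -
      have "sigma * (- (1/500)) + sigma\<^sup>2 * 204800000000 \<le> - (1 / 10^18)"
        unfolding sigma_def by (simp add: power2_eq_square)
      then have "d0 * (sigma * (- (1/500)) + sigma\<^sup>2 * 204800000000) \<le> d0 * - (1 / 10^18)"
        using d0 by (intro mult_left_mono) auto
      then show ?thesis by (simp add: algebra_simps)
    qed
    ultimately have "d0 * sigma * (s * (Z [] i - 1) - 1/500) + (d0 * sigma * 320000 / dd i)\<^sup>2 * (2 * dd i - touched [] i) \<le> d0 * - (1 / 10^18)"
      by (simp only: diff_self mult_zero_right diff_0 diff_0_right)
    then show ?thesis unfolding WZ_def by simp
  qed
  have "Psi [] \<le> (\<Sum>u<nv. \<Sum>c<C. exp (- d0 / 10^18)) + (\<Sum>i<length dat. exp (- d0 / 10^18) + exp (- d0 / 10^18))"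
    unfolding Psi_def using Y Z by (intro add_mono sum_mono) auto
  then show ?thesis by (simp add: algebra_simps)
qed

text \<open>Induction over the remaining edges. While the history is \<open>ok\<close>, the mean of
  \<open>Psi\<close> does not grow; at the first failure \<open>Psi\<close> is at least
  \<open>1\<close>, which bounds any probability.\<close>

lemma color_process_bad_le_Psi:
  assumes "good r" "drop (length r) dat = es" "0 < C"
  shows "measure_pmf.prob (color_process C es r) {r'. \<not> (good r' \<and> map fst r' = rev dat)} \<le> Psi r"
  using assms(1,2)
proof (induction es arbitrary: r)
  case Nil
  then have "length dat \<le> length r" by simp
  then have "map fst r = rev dat" using good_fst[OF Nil(1)] by simp
  then show ?case using Nil Psi_nonneg by simp
next
  case (Cons e es)
  have j: "length r < length dat" using Cons.prems(2) by (cases "length r < length dat") auto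
  have e: "e = dat ! length r" and es: "drop (Suc (length r)) dat = es"
    using Cons_nth_drop_Suc[OF j] Cons.prems(2) by auto
  show ?case
  proof (cases "ok r")
    case False
    then show ?thesis using Psi_bad[OF Cons.prems(1)] measure_pmf.prob_le_1 order_trans by blast
  next
    case True
    let ?q = "color_prob C (phi C r) e"
    let ?E = "{r'. \<not> (good r' \<and> map fst r' = rev dat)}"
    note qf = color_prob_facts[OF Cons.prems(1) True j, folded e]
    have "measure_pmf.prob (color_process C (e # es) r) ?E =
       (\<Sum>k<C. pmf (color_pmf C (phi C r) e) k * measure_pmf.prob (color_process C es ((e, k) # r)) ?E)"
      using set_color_pmf_less[OF assms(3)] by (simp add: prob_bind_pmf_finite)
    also have "\<dots> = (\<Sum>k<C. ?q k * measure_pmf.prob (color_process C es ((e, k) # r)) ?E)"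
      using qf by (intro sum.cong) (auto simp: pmf_color_pmf)
    also have "\<dots> \<le> (\<Sum>k<C. ?q k * Psi ((e, k) # r))"
    proof (rule sum_mono)
      fix k assume k: "k \<in> {..<C}"
      show "?q k * measure_pmf.prob (color_process C es ((e, k) # r)) ?E \<le> ?q k * Psi ((e, k) # r)"
      proof (cases "?q k = 0")
        case False
        then have "0 < ?q k" using qf(3)[of k] k by simp
        then have "good ((e, k) # r)" using Cons.prems(1) True j e k by simp
        then show ?thesis using Cons.IH[of "(e, k) # r"] es qf(3)[of k] k
          by (intro mult_left_mono) auto
      qed simp
    qed
    also have "\<dots> \<le> Psi r" using Psi_step[OF Cons.prems(1) True j] unfolding e .
    finally show ?thesis .
  qed
qed

theorem color_process_good:
  assumes "0 < C"
  shows "measure_pmf.prob (color_process C dat []) {r. \<not> (good r \<and> map fst r = rev dat)}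
    \<le> (real nv * real C + 2 * real (length dat)) * exp (- d0 / 10^18)"
  using color_process_bad_le_Psi[of "[]" dat] Psi_Nil assms by simp

lemma good_proper:
  "good r \<Longrightarrow> sorted_wrt (\<lambda>ek ek'. ends (fst ek) \<inter> ends (fst ek') \<noteq> {} \<longrightarrow> snd ek \<noteq> snd ek') r"
proof (induction r)
  case (Cons ek r)
  have "snd ek \<noteq> snd ek'" if "ek' \<in> set r" "ends (fst ek) \<inter> ends (fst ek') \<noteq> {}" for ek'
  proof
    assume eq: "snd ek = snd ek'"
    obtain v where v: "v \<in> ends (fst ek)" "v \<in> ends (fst ek')" using \<open>ends (fst ek) \<inter> _ \<noteq> _\<close> by auto
    have "phi C r v (snd ek) = 0"
      using phi_used[of "fst ek'" "snd ek'" r v C] that v eq by (cases ek') auto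
    then have "weight (phi C r) (fst ek) (snd ek) = 0" using v unfolding weight_def ends_def by auto
    then have "color_prob C (phi C r) (fst ek) (snd ek) = 0" unfolding color_prob_def by simp
    moreover have "0 < color_prob C (phi C r) (fst ek) (snd ek)" using Cons.prems unfolding good.simps by blast
    ultimately show False by simp
  qed
  then show ?case using Cons by simp
qed simp

text \<open>This keeps every colour within the palette of its arrival time, so the colours used
  follow the true degree although \<open>C\<close> may be far larger.\<close>

lemma good_support: "good r \<Longrightarrow> ek \<in> set r \<Longrightarrow> snd (snd (fst ek)) (snd ek) \<noteq> 0"
  by (induction r) (auto simp: color_prob_def weight_def)

end

section \<open>From behaviour to mixed strategies\<close>

primrec run :: "(edge_rec \<times> color_hist \<Rightarrow> nat) \<Rightarrow> edge_rec list \<Rightarrow> color_hist \<Rightarrow> color_hist" where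
  "run F [] r = r"
| "run F (e # es) r = run F es ((e, F (e, r)) # r)"

lemma run_append: "run F (es @ es') r = run F es' (run F es r)"
  by (induction es arbitrary: r) auto

lemma set_run_mono: "set r \<subseteq> set (run F es r)"
  by (induction es arbitrary: r) fastforce+

text \<open>A run never consults histories shorter than its start, so an answer given earlier may be
  changed freely.\<close>

lemma run_cong_longer:
  assumes "\<And>e s. length r \<le> length s \<Longrightarrow> F (e, s) = F' (e, s)"
  shows "run F es r = run F' es r"
  using assms
proof (induction es arbitrary: r)
  case (Cons e es)
  have "run F es ((e, F (e, r)) # r) = run F' es ((e, F (e, r)) # r)"
    using Cons.prems by (intro Cons.IH) simp
  then show ?case using Cons.prems by simp
qed simp

text \<open>An instance of Kuhn's equivalence of behaviour and mixed strategies: histories grow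
  along a run, so each key is consulted at most once and its answer may be drawn independently
  beforehand.\<close>

lemma run_Pi_pmf:
  assumes "finite I"
    and "\<And>e s. e \<in> set es \<Longrightarrow> set s \<subseteq> R \<times> {..<C} \<Longrightarrow> length s < length r + length es \<Longrightarrow>
      length r \<le> length s \<Longrightarrow> (e, s) \<in> I"
    and "set r \<subseteq> R \<times> {..<C}" "set es \<subseteq> R" "0 < C"
  shows "map_pmf (\<lambda>F. run F es r) (Pi_pmf I 0 (\<lambda>(e, s). color_pmf C (phi C s) e)) = color_process C es r"
  using assms
proof (induction es arbitrary: r I)
  case Nil
  then show ?case by simp
next
  case (Cons e es)
  let ?p = "\<lambda>(e, s). color_pmf C (phi C s) e"
  define J where "J = I - {(e, r)}"
  have I: "I = insert (e, r) J" "(e, r) \<notin> J" "finite J"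
    using Cons.prems(1) Cons.prems(2)[of e r] Cons.prems(3) unfolding J_def by auto
  have upd: "run (f((e, r) := k)) (e # es) r = run f es ((e, k) # r)" for f k
    by (simp, rule run_cong_longer) auto
  have IH: "map_pmf (\<lambda>F. run F es ((e, k) # r)) (Pi_pmf J 0 ?p) = color_process C es ((e, k) # r)"
    if k: "k \<in> set_pmf (color_pmf C (phi C r) e)" for k
  proof (rule Cons.IH)
    show "finite J" by (rule I)
    show "(e', s) \<in> J" if "e' \<in> set es" "set s \<subseteq> R \<times> {..<C}"
      "length s < length ((e, k) # r) + length es" "length ((e, k) # r) \<le> length s" for e' s
      using Cons.prems(2)[of e' s] that unfolding J_def by auto
    show "set ((e, k) # r) \<subseteq> R \<times> {..<C}"
      using Cons.prems(3,4,5) k set_color_pmf_less[of C "phi C r" e] by auto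
  qed (use Cons.prems in auto)
  have "map_pmf (\<lambda>F. run F (e # es) r) (Pi_pmf I 0 ?p) =
      bind_pmf (color_pmf C (phi C r) e) (\<lambda>k. map_pmf (\<lambda>F. run F es ((e, k) # r)) (Pi_pmf J 0 ?p))"
  proof -
    have ins: "Pi_pmf I 0 ?p = bind_pmf (color_pmf C (phi C r) e) (\<lambda>k. bind_pmf (Pi_pmf J 0 ?p) (\<lambda>f. return_pmf (f((e, r) := k))))"
      unfolding I(1) using Pi_pmf_insert'[OF I(3,2), of 0 ?p] by simp
    show ?thesis unfolding ins
      by (simp only: map_bind_pmf map_return_pmf upd) (simp add: map_pmf_def)
  qed
  also have "\<dots> = color_process C (e # es) r"
    using IH by (auto intro: bind_pmf_cong)
  finally show ?case .
qed

section \<open>The algorithm\<close>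

primrec edge_recs :: "nat \<Rightarrow> nat set list \<Rightarrow> edge_rec list" where
  "edge_recs d0 [] = []"
| "edge_recs d0 (N # g) = edge_recs d0 g @
     map (\<lambda>s. (length g, s, level (load d0 g s) (dmax d0 (N # g)))) (sorted_list_of_set N)"

text \<open>The newest arrival comes first, so this suffix of length \<open>Suc t\<close> is the
  history up to and including arrival \<open>t\<close>.\<close>

definition dmax_at :: "nat \<Rightarrow> nat set list \<Rightarrow> nat \<Rightarrow> nat" where
  "dmax_at d0 g t = dmax d0 (drop (length g - Suc t) g)"

section \<open>Structure of the recorded edges\<close>

lemma hist_ok_drop: "hist_ok g \<Longrightarrow> hist_ok (drop n g)"
proof (induction g arbitrary: n)
  case (Cons N g)
  then show ?case by (cases n) auto
qed simp

lemma dmax_drop_le: "dmax d0 (drop n g) \<le> dmax d0 g"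
proof (induction g arbitrary: n)
  case (Cons N g)
  show ?case
  proof (cases n)
    case (Suc m)
    then show ?thesis using Cons.IH[of m] dmax_mono[of d0 g N] by simp
  qed simp
qed simp

lemma edge_recs_elem:
  assumes "hist_ok g" "e \<in> set (edge_recs d0 g)"
  shows "fst (snd e) < fst e \<and> fst e < length g \<and> (\<exists>L. snd (snd e) = level L (dmax_at d0 g (fst e)))"
  using assms
proof (induction g)
  case (Cons N g)
  have N: "N \<subseteq> {..<length g}" "hist_ok g" "finite N" using Cons.prems(1) finite_subset by auto
  show ?case
  proof (cases "e \<in> set (edge_recs d0 g)")
    case True
    then have "fst e < length g" using Cons.IH N by simp
    then have "dmax_at d0 (N # g) (fst e) = dmax_at d0 g (fst e)"
      unfolding dmax_at_def by (simp add: Suc_diff_Suc[symmetric] del: Suc_diff_Suc)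
    then show ?thesis using Cons.IH N True by auto
  next
    case False
    then obtain s where "s \<in> N" "e = (length g, s, level (load d0 g s) (dmax d0 (N # g)))"
      using Cons.prems(2) N(3) by auto
    then show ?thesis using N(1) unfolding dmax_at_def by auto
  qed
qed simp

lemma distinct_edge_recs: "hist_ok g \<Longrightarrow> distinct (map (\<lambda>e. (fst e, fst (snd e))) (edge_recs d0 g))"
proof (induction g)
  case (Cons N g)
  then have N: "N \<subseteq> {..<length g}" "hist_ok g" "finite N" using finite_subset by auto
  have "fst e < length g" if "e \<in> set (edge_recs d0 g)" for e
    using edge_recs_elem[OF N(2) that] by simp
  then show ?case using Cons.IH N by (fastforce simp: comp_def distinct_map inj_on_def)
qed simp

lemma edge_recs_load:
  assumes "hist_ok g"
  shows "(\<Sum>e\<leftarrow>edge_recs d0 g. if u \<in> ends e then snd (snd e) c else 0) = load d0 g u c"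
  using assms
proof (induction g)
  case (Cons N g)
  then have N: "N \<subseteq> {..<length g}" "hist_ok g" "finite N" using finite_subset by auto
  let ?x = "\<lambda>s. level (load d0 g s) (dmax d0 (N # g)) c"
  let ?e = "\<lambda>s. (length g, s, level (load d0 g s) (dmax d0 (N # g)))"
  have "(\<Sum>e\<leftarrow>map ?e (sorted_list_of_set N). if u \<in> ends e then snd (snd e) c else 0)
      = (\<Sum>s\<leftarrow>sorted_list_of_set N. if u = length g \<or> u = s then ?x s else 0)"
    unfolding map_map comp_def ends_def by (intro arg_cong[of _ _ sum_list] map_cong) auto
  also have "\<dots> = (\<Sum>s\<in>N. if u = length g \<or> u = s then ?x s else 0)"
    using N(3) sum_list_distinct_conv_sum_set[of "sorted_list_of_set N"] by simp
  also have "\<dots> = (if u \<in> N then ?x u else 0) + (if u = length g then \<Sum>s\<in>N. ?x s else 0)"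
    using N by (cases "u = length g") auto
  finally show ?case using Cons.IH N unfolding edge_recs.simps map_append sum_list_append load.simps by simp
qed simp

lemma edge_recs_degree:
  assumes "hist_ok g"
  shows "length (filter (\<lambda>e. u \<in> ends e) (edge_recs d0 g)) = arrived_degree g u"
  using assms
proof (induction g)
  case (Cons N g)
  then have N: "N \<subseteq> {..<length g}" "hist_ok g" "finite N" using finite_subset by auto
  have "length (filter (\<lambda>s. u = length g \<or> u = s) (sorted_list_of_set N)) =
      card ({s. u = length g \<or> u = s} \<inter> N)"
    using N(3) by (simp add: distinct_length_filter)
  also have "\<dots> = (if u \<in> N then 1 else 0) + (if u = length g then card N else 0)"
  proof (cases "u = length g")
    case True
    then have "u \<notin> N" using N by auto
    then show ?thesis using True by simp
  next
    case False
    then have "{s. u = length g \<or> u = s} \<inter> N = (if u \<in> N then {u} else {})" by auto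
    then show ?thesis using False by simp
  qed
  finally show ?case using Cons.IH N by (simp add: comp_def ends_def filter_map)
qed simp

text \<open>Edges are recorded arrival by arrival, so an earlier history yields an initial segment.
  This makes recomputed runs agree with each other.\<close>

lemma edge_recs_prefix: "\<exists>zs. edge_recs d0 g = edge_recs d0 (drop n g) @ zs \<and> (\<forall>e\<in>set zs. length (drop n g) \<le> fst e)"
proof (induction g arbitrary: n)
  case (Cons N g)
  show ?case
  proof (cases n)
    case (Suc m)
    obtain zs where zs: "edge_recs d0 g = edge_recs d0 (drop m g) @ zs" "\<forall>e\<in>set zs. length (drop m g) \<le> fst e"
      using Cons.IH by blast
    show ?thesis unfolding Suc using zs
      by (intro exI[of _ "zs @ map (\<lambda>s. (length g, s, level (load d0 g s) (dmax d0 (N # g)))) (sorted_list_of_set N)"]) auto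
  qed simp
qed simp

lemma length_edge_recs: "hist_ok g \<Longrightarrow> length (edge_recs d0 g) \<le> length g * length g"
proof (induction g)
  case (Cons N g)
  then have "card N \<le> length g" using card_mono[of "{..<length g}" N] by simp
  then show ?case using Cons by simp
qed simp

lemma degree_le_length: "hist_ok g \<Longrightarrow> arrived_degree g u \<le> length g"
proof (induction g)
  case (Cons N g)
  then have N: "N \<subseteq> {..<length g}" "hist_ok g" by auto
  then have c: "card N \<le> length g" using card_mono[of "{..<length g}" N] by simp
  show ?case
  proof (cases "u = length g")
    case True
    then have "u \<notin> N" using N by auto
    then show ?thesis using True c degree_fresh[OF N(2), of u] by simp
  next
    case False
    then show ?thesis using Cons.IH[OF N(2)] by simp
  qed
qed simp

lemma dmax_le: "hist_ok g \<Longrightarrow> dmax d0 g \<le> max d0 (length g)"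
  unfolding dmax_def using degree_le_length by (intro Max.boundedI) (auto simp: max.coboundedI2)

lemma rounding_edge_recs:
  assumes d0: "400000 \<le> d0" and g: "hist_ok g" and C: "ncol (dmax d0 g) \<le> C"
  shows "rounding (edge_recs d0 g) C (length g) (\<lambda>i. dmax_at d0 g (fst (edge_recs d0 g ! i))) d0"
proof -
  let ?dat = "edge_recs d0 g"
  let ?dd = "\<lambda>i. dmax_at d0 g (fst (?dat ! i))"
  have el: "fst (snd (?dat ! i)) < fst (?dat ! i)" "fst (?dat ! i) < length g"
    "\<exists>L. snd (snd (?dat ! i)) = level L (?dd i)" if "i < length ?dat" for i
    using edge_recs_elem[OF g nth_mem[OF that]] by auto
  have dd: "d0 \<le> ?dd i" for i unfolding dmax_at_def by (rule dmax_ge)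
  then have dd1: "1000 \<le> ?dd i" for i using d0 dd[of i] by linarith
  have dC: "ncol (?dd i) \<le> C" for i
    unfolding dmax_at_def by (rule order_trans[OF ncol_mono[OF dmax_drop_le] C])
  show ?thesis
  proof
    show "400000 \<le> real d0" using d0 by simp
    show "real d0 \<le> real (?dd i)" for i using dd by simp
    show "ends (?dat ! i) \<subseteq> {..<length g}" if "i < length ?dat" for i
      using el[OF that] unfolding ends_def by auto
    show "fst (?dat ! i) \<noteq> fst (snd (?dat ! i))" if "i < length ?dat" for i
      using el[OF that] by auto
    show "inj_on (\<lambda>i. ends (?dat ! i)) {..<length ?dat}"
    proof (rule inj_onI)
      fix i j assume ij: "i \<in> {..<length ?dat}" "j \<in> {..<length ?dat}" "ends (?dat ! i) = ends (?dat ! j)"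
      then have "fst (?dat ! i) = fst (?dat ! j) \<and> fst (snd (?dat ! i)) = fst (snd (?dat ! j))"
        using el[of i] el[of j] unfolding ends_def by (auto simp: doubleton_eq_iff)
      then show "i = j" using nth_eq_iff_index_eq[OF distinct_edge_recs[OF g, of d0], of i j] ij by simp
    qed
    fix i assume i: "i < length ?dat"
    obtain L where L: "snd (snd (?dat ! i)) = level L (?dd i)" using el(3)[OF i] by auto
    show "0 \<le> snd (snd (?dat ! i)) c" for c unfolding L using level_nonneg[OF dd1] .
    show "snd (snd (?dat ! i)) c \<le> 1 / real (?dd i)" for c
    proof -
      have "level L (?dd i) c \<le> 97 / (100 * real (?dd i))" using level_le[OF dd1] .
      also have "\<dots> \<le> 1 / real (?dd i)" using dd1[of i] by (simp add: field_simps)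
      finally show ?thesis unfolding L .
    qed
    have "(\<Sum>c<C. level L (?dd i) c) = (\<Sum>c<ncol (?dd i). level L (?dd i) c)"
      using dC[of i] level_outside[OF dd1[of i]] by (intro sum.mono_neutral_right) auto
    then show "(\<Sum>c<C. snd (snd (?dat ! i)) c) = 1" unfolding L using sum_level[OF dd1] by simp
    let ?t = "fst (?dat ! i)"
    \<comment> \<open>\<open>g'\<close> is the history when edge \<open>i\<close> arrives. All
      earlier edges lie in it, so those touching edge \<open>i\<close> are counted by the degrees of
      its two endpoints at that time.\<close>
    define g' where "g' = drop (length g - Suc ?t) g"
    have g': "hist_ok g'" "length g' = Suc ?t" using g el(2)[OF i] unfolding g'_def by (auto simp: hist_ok_drop)
    obtain zs where zs: "?dat = edge_recs d0 g' @ zs" "\<forall>e\<in>set zs. length g' \<le> fst e"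
      using edge_recs_prefix[of d0 g "length g - Suc ?t"] unfolding g'_def by blast
    have il: "i < length (edge_recs d0 g')"
    proof (rule ccontr)
      assume "\<not> ?thesis"
      then have "?dat ! i \<in> set zs" using i unfolding zs(1) by (simp add: nth_append)
      then show False using zs(2) g'(2) by auto
    qed
    have deg: "card {l. l < i \<and> u \<in> ends (?dat ! l)} \<le> ?dd i" if "u < length g'" for u
    proof -
      have "card {l. l < i \<and> u \<in> ends (?dat ! l)} \<le> card {l. l < length (edge_recs d0 g') \<and> u \<in> ends (edge_recs d0 g' ! l)}"
        using il zs(1) by (intro card_mono) (auto simp: nth_append)
      also have "\<dots> = arrived_degree g' u" using edge_recs_degree[OF g'(1)] by (simp add: length_filter_conv_card)
      also have "\<dots> \<le> ?dd i" unfolding dmax_at_def g'_def[symmetric] by (rule degree_le_dmax[OF that])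
      finally show ?thesis .
    qed
    have "{l. l < i \<and> ends (?dat ! l) \<inter> ends (?dat ! i) \<noteq> {}} \<subseteq>
        {l. l < i \<and> ?t \<in> ends (?dat ! l)} \<union> {l. l < i \<and> fst (snd (?dat ! i)) \<in> ends (?dat ! l)}"
      unfolding ends_def[of "?dat ! i"] by auto
    then have "card {l. l < i \<and> ends (?dat ! l) \<inter> ends (?dat ! i) \<noteq> {}} \<le>
        card ({l. l < i \<and> ?t \<in> ends (?dat ! l)} \<union> {l. l < i \<and> fst (snd (?dat ! i)) \<in> ends (?dat ! l)})"
      by (intro card_mono) auto
    also have "\<dots> \<le> card {l. l < i \<and> ?t \<in> ends (?dat ! l)} + card {l. l < i \<and> fst (snd (?dat ! i)) \<in> ends (?dat ! l)}"
      by (rule card_Un_le)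
    also have "\<dots> \<le> 2 * ?dd i"
      using deg[of ?t] deg[of "fst (snd (?dat ! i))"] g'(2) el(1)[OF i] by simp
    finally have "card {l. l < i \<and> ends (?dat ! l) \<inter> ends (?dat ! i) \<noteq> {}} \<le> 2 * ?dd i" .
    from of_nat_mono[OF this, where 'a = real]
    show "real (card {l. l < i \<and> ends (?dat ! l) \<inter> ends (?dat ! i) \<noteq> {}}) \<le> 2 * real (?dd i)" by simp
  next
    fix u c
    have "(\<Sum>i | i < length ?dat \<and> u \<in> ends (?dat ! i). snd (snd (?dat ! i)) c) =
        (\<Sum>i<length ?dat. if u \<in> ends (?dat ! i) then snd (snd (?dat ! i)) c else 0)"
      by (simp add: sum.If_cases Int_def lessThan_def)
    also have "\<dots> = (\<Sum>e\<leftarrow>?dat. if u \<in> ends e then snd (snd e) c else 0)"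
      by (simp add: sum_list_sum_nth atLeast0LessThan)
    also have "\<dots> = load d0 g u c" by (rule edge_recs_load[OF g])
    also have "\<dots> \<le> 99/100" using d0 g by (intro load_le) auto
    finally show "(\<Sum>i | i < length ?dat \<and> u \<in> ends (?dat ! i). snd (snd (?dat ! i)) c) \<le> 99/100" .
  qed
qed

text \<open>Degrees on \<open>n\<close> vertices are at most \<open>n\<close>, so this range of
  colours suffices for every history; the successor keeps it nonempty.\<close>

definition palette :: "nat \<Rightarrow> nat \<Rightarrow> nat" where
  "palette n d0 = Suc (ncol (max d0 n))"

definition rec_set :: "nat \<Rightarrow> nat \<Rightarrow> edge_rec set" where
  "rec_set n d0 = (\<Union>g\<in>{g. set g \<subseteq> Pow {..<n} \<and> length g \<le> n}. set (edge_recs d0 g))"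

text \<open>A finite set containing every query that can occur, as needed for the independent
  product; a run has at most \<open>n * n\<close> edges.\<close>

definition keys :: "nat \<Rightarrow> nat \<Rightarrow> (edge_rec \<times> color_hist) set" where
  "keys n d0 = rec_set n d0 \<times> {s. set s \<subseteq> rec_set n d0 \<times> {..<palette n d0} \<and> length s \<le> n * n}"

text \<open>
  The deterministic algorithm answers by recomputing the whole run on the revealed history
  from the tape \<open>F\<close>. A prefix of the history yields a prefix of the run, so the answers given
  at different times are consistent.
\<close>

definition replay :: "nat \<Rightarrow> (edge_rec \<times> color_hist \<Rightarrow> nat) \<Rightarrow> det_online_algorithm" where
  "replay d0 F h s = (THE k. \<exists>y. ((length h - 1, s, y), k) \<in> set (run F (edge_recs d0 (rev h)) []))"

definition rounding_algorithm :: online_algorithm where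
  "rounding_algorithm n d0 = map_pmf (replay d0) (Pi_pmf (keys n d0) 0 (\<lambda>(e, s). color_pmf (palette n d0) (phi (palette n d0) s) e))"

lemma finite_keys: "finite (keys n d0)"
proof -
  have "finite (rec_set n d0)" unfolding rec_set_def
    by (intro finite_UN_I finite_lists_length_le) auto
  then show ?thesis unfolding keys_def by (intro finite_cartesian_product finite_lists_length_le) auto
qed

lemma map_fst_run: "map fst (run F es r) = rev es @ map fst r"
  by (induction es arbitrary: r) auto

lemma sorted_wrt_set:
  "sorted_wrt P xs \<Longrightarrow> a \<in> set xs \<Longrightarrow> b \<in> set xs \<Longrightarrow> a \<noteq> b \<Longrightarrow> P a b \<or> P b a"
  by (induction xs) auto

section \<open>From graphs and arrival orders to histories\<close>

definition ghist :: "'v set set \<Rightarrow> 'v list \<Rightarrow> nat \<Rightarrow> nat set list" where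
  "ghist E vs t = rev (map (back_neighbours E vs) [0..<t])"

lemma ghist_simps [simp]: "ghist E vs 0 = []" "ghist E vs (Suc t) = back_neighbours E vs t # ghist E vs t"
  unfolding ghist_def by auto

lemma length_ghist [simp]: "length (ghist E vs t) = t"
  unfolding ghist_def by simp

lemma hist_ok_ghist: "hist_ok (ghist E vs t)"
  by (induction t) (auto simp: back_neighbours_def)

lemma drop_ghist: "t \<le> n \<Longrightarrow> drop (n - t) (ghist E vs n) = ghist E vs t"
proof (induction n)
  case (Suc n)
  then show ?case by (cases "t = Suc n") (auto simp: Suc_diff_le)
qed simp

lemma degree_ghist: "arrived_degree (ghist E vs t) u =
    (if u < t then card (back_neighbours E vs u) else 0) + card {i. i < t \<and> u \<in> back_neighbours E vs i}"
proof (induction t)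
  case (Suc t)
  have "{i. i < Suc t \<and> u \<in> back_neighbours E vs i} =
     (if u \<in> back_neighbours E vs t then {t} else {}) \<union> {i. i < t \<and> u \<in> back_neighbours E vs i}"
    by (auto simp: less_Suc_eq)
  then show ?case using Suc by (auto simp: back_neighbours_def)
qed simp

lemma edge_recs_ghist:
  "(\<exists>y. (t, s, y) \<in> set (edge_recs d0 (ghist E vs n))) \<longleftrightarrow> t < n \<and> s \<in> back_neighbours E vs t"
proof (induction n)
  case (Suc n)
  have "finite (back_neighbours E vs n)" unfolding back_neighbours_def by simp
  then show ?case using Suc by (auto simp: less_Suc_eq)
qed simp

context
  fixes V :: "'v set" and E :: "'v set set" and vs :: "'v list" and n :: nat
  assumes G: "simple_graph V E" "card V = n" "arrival_order V vs"
begin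

lemma vs_facts: "distinct vs" "set vs = V" "length vs = n"
  using G distinct_card[of vs] unfolding arrival_order_def by auto

lemma finite_E: "finite E"
  using G(1) finite_subset[of E "Pow V"] unfolding simple_graph_def by auto

lemma edge_cases:
  assumes "e \<in> E"
  obtains s t where "s < t" "t < n" "e = {vs ! s, vs ! t}" "s \<in> back_neighbours E vs t"
proof -
  have "e \<subseteq> V" "card e = 2" using assms G(1) unfolding simple_graph_def by auto
  then obtain a b where ab: "e = {a, b}" "a \<noteq> b" "a \<in> set vs" "b \<in> set vs"
    using vs_facts(2) by (auto simp: card_2_iff)
  then obtain i j where "i < n" "j < n" "a = vs ! i" "b = vs ! j" "i \<noteq> j"
    using vs_facts(3) by (metis in_set_conv_nth)
  then consider "i < j" | "j < i" by linarith
  then show thesis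
  proof cases
    case 1
    then show ?thesis using that[of i j] \<open>j < n\<close> ab \<open>a = _\<close> \<open>b = _\<close> assms unfolding back_neighbours_def by auto
  next
    case 2
    then show ?thesis using that[of j i] \<open>i < n\<close> ab \<open>a = _\<close> \<open>b = _\<close> assms unfolding back_neighbours_def
      by (auto simp: insert_commute)
  qed
qed

lemma degree_le: "degree E v \<le> n"
proof -
  have "{e \<in> E. v \<in> e} \<subseteq> (\<lambda>w. {v, w}) ` V"
  proof
    fix e assume e: "e \<in> {e \<in> E. v \<in> e}"
    then have "e \<subseteq> V" "card e = 2" using G(1) unfolding simple_graph_def by auto
    then obtain a b where "e = {a, b}" "a \<in> V" "b \<in> V" by (auto simp: card_2_iff)
    then show "e \<in> (\<lambda>w. {v, w}) ` V" using e by (auto simp: insert_commute)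
  qed
  then have "card {e \<in> E. v \<in> e} \<le> card ((\<lambda>w. {v, w}) ` V)"
    using G(1) unfolding simple_graph_def by (intro card_mono) auto
  also have "\<dots> \<le> n" using G card_image_le[of V] unfolding simple_graph_def by auto
  finally show ?thesis unfolding degree_def .
qed

lemma max_degree_le: "max_degree V E \<le> n"
  unfolding max_degree_def using G(1) degree_le unfolding simple_graph_def by (intro Max.boundedI) auto

lemma degree_le_degree: "u < n \<Longrightarrow> arrived_degree (ghist E vs n) u \<le> degree E (vs ! u)"
proof -
  assume u: "u < n"
  let ?A = "back_neighbours E vs u" and ?B = "{i. i < n \<and> u \<in> back_neighbours E vs i}"
  have d: "?A \<inter> ?B = {}" "finite ?A" "finite ?B" unfolding back_neighbours_def by auto
  have "arrived_degree (ghist E vs n) u = card (?A \<union> ?B)"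
    using u card_Un_disjoint[OF d(2,3,1)] unfolding degree_ghist by simp
  also have "\<dots> \<le> card {e \<in> E. vs ! u \<in> e}"
  proof (rule card_inj_on_le[of "\<lambda>i. {vs ! i, vs ! u}"])
    show "inj_on (\<lambda>i. {vs ! i, vs ! u}) (?A \<union> ?B)"
    proof (rule inj_onI)
      fix i j assume "i \<in> ?A \<union> ?B" "j \<in> ?A \<union> ?B" and eq: "{vs ! i, vs ! u} = {vs ! j, vs ! u}"
      then have "i < n" "j < n" using u unfolding back_neighbours_def by auto
      moreover have "vs ! i = vs ! j" using eq by (auto simp: doubleton_eq_iff)
      ultimately show "i = j" using vs_facts by (simp add: nth_eq_iff_index_eq)
    qed
    show "(\<lambda>i. {vs ! i, vs ! u}) ` (?A \<union> ?B) \<subseteq> {e \<in> E. vs ! u \<in> e}"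
      unfolding back_neighbours_def by (auto simp: insert_commute)
  qed (simp add: finite_E)
  finally show ?thesis unfolding degree_def .
qed

lemma dmax_ghist_le: "d0 \<le> max_degree V E \<Longrightarrow> dmax d0 (ghist E vs n) \<le> max_degree V E"
proof -
  assume d0: "d0 \<le> max_degree V E"
  have "degree E (vs ! u) \<le> max_degree V E" if "u < n" for u
    unfolding max_degree_def using G(1) that vs_facts nth_mem[of u vs] unfolding simple_graph_def
    by (intro Max_ge) auto
  then have "arrived_degree (ghist E vs n) u \<le> max_degree V E" if "u < n" for u
    using degree_le_degree[OF that] that le_trans by blast
  then show ?thesis using d0 unfolding dmax_def by (intro Max.boundedI) auto
qed

text \<open>The run recomputed at arrival \<open>t\<close> is part of the full run, and the pair of
  endpoints determines the record, so the description in \<open>replay\<close> is unique.\<close>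

lemma replay_edge:
  assumes st: "s < t" "t < n" "s \<in> back_neighbours E vs t"
  shows "\<exists>y k. ((t, s, y), k) \<in> set (run F (edge_recs d0 (ghist E vs n)) []) \<and>
    edge_color (replay d0 F) E vs {vs ! s, vs ! t} = k"
proof -
  let ?r = "run F (edge_recs d0 (ghist E vs n)) []"
  let ?r' = "run F (edge_recs d0 (ghist E vs (Suc t))) []"
  have rt: "rev (revealed E vs t) = ghist E vs (Suc t)" "length (revealed E vs t) - 1 = t"
    unfolding revealed_def ghist_def by auto
  obtain zs where "edge_recs d0 (ghist E vs n) = edge_recs d0 (ghist E vs (Suc t)) @ zs"
    using edge_recs_prefix[of d0 "ghist E vs n" "n - Suc t"] drop_ghist[of "Suc t" n E vs] st by auto
  then have sub: "set ?r' \<subseteq> set ?r" using set_run_mono by (simp add: run_append)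
  have fr: "map fst ?r = rev (edge_recs d0 (ghist E vs n))" "map fst ?r' = rev (edge_recs d0 (ghist E vs (Suc t)))"
    using map_fst_run[of F _ "[]"] by auto
  have "\<exists>y. (t, s, y) \<in> set (edge_recs d0 (ghist E vs (Suc t)))"
    unfolding edge_recs_ghist using st by simp
  then obtain y where "(t, s, y) \<in> set (edge_recs d0 (ghist E vs (Suc t)))" ..
  then have "(t, s, y) \<in> set (map fst ?r')" unfolding fr set_rev .
  then obtain k where k: "((t, s, y), k) \<in> set ?r'" by auto
  have "distinct (map (\<lambda>ek. (fst (fst ek), fst (snd (fst ek)))) ?r)"
  proof -
    have "map (\<lambda>ek. (fst (fst ek), fst (snd (fst ek)))) ?r = map (\<lambda>e. (fst e, fst (snd e))) (map fst ?r)"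
      by simp
    also have "\<dots> = rev (map (\<lambda>e. (fst e, fst (snd e))) (edge_recs d0 (ghist E vs n)))"
      unfolding fr by (rule rev_map[symmetric])
    finally show ?thesis using distinct_edge_recs[OF hist_ok_ghist, of d0 E vs n] by (simp only: distinct_rev)
  qed
  then have inj: "inj_on (\<lambda>ek. (fst (fst ek), fst (snd (fst ek)))) (set ?r)" by (simp add: distinct_map)
  have uniq: "k' = k" if "((t, s, y'), k') \<in> set ?r'" for y' k'
    using inj_onD[OF inj, of "((t, s, y'), k')" "((t, s, y), k)"] that k sub by auto
  have "edge_color (replay d0 F) E vs {vs ! s, vs ! t} = replay d0 F (revealed E vs t) s"
    using edge_color_eq[OF vs_facts(1) st(1)] st(2) vs_facts(3) by simp
  also have "\<dots> = k" unfolding replay_def rt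
  proof (rule the_equality)
    show "\<exists>y. ((t, s, y), k) \<in> set ?r'" using k by blast
  qed (use uniq in blast)
  finally show ?thesis using k sub by blast
qed

lemma success:
  assumes d0: "400000 \<le> d0" "d0 \<le> max_degree V E"
  shows "1 - 5 * (real n)\<^sup>2 * exp (- real d0 / 10^18) \<le>
    measure_pmf.prob (rounding_algorithm n d0)
      {alg. proper_edge_coloring E (edge_color alg E vs) \<and>
        real (card (edge_color alg E vs ` E)) \<le> 1.777 * real (max_degree V E)}"
proof -
  define C where "C = palette n d0"
  define g where "g = ghist E vs n"
  define dat where "dat = edge_recs d0 g"
  have ok: "hist_ok g" "length g = n" unfolding g_def by (auto simp: hist_ok_ghist)
  have d0n: "d0 \<le> n" using d0 max_degree_le by simp
  have "dmax d0 g \<le> max d0 n" using dmax_le[OF ok(1)] ok(2) by simp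
  then have dC: "ncol (dmax d0 g) \<le> C" unfolding C_def palette_def by (intro le_SucI ncol_mono)
  interpret R: rounding dat C n "\<lambda>i. dmax_at d0 g (fst (dat ! i))" d0
    using rounding_edge_recs[OF d0(1) ok(1) dC] unfolding dat_def ok(2) .
  have C0: "0 < C" unfolding C_def palette_def by simp
  let ?ok = "{r. R.good r \<and> map fst r = rev dat}"
  let ?S = "{alg. proper_edge_coloring E (edge_color alg E vs) \<and>
        real (card (edge_color alg E vs ` E)) \<le> 1.777 * real (max_degree V E)}"
  let ?P = "Pi_pmf (keys n d0) 0 (\<lambda>(e, s). color_pmf C (phi C s) e)"
  have good: "replay d0 F \<in> ?S" if gd: "R.good (run F dat [])" for F
  proof -
    let ?r = "run F dat []"
    have col: "\<exists>y. ((t, s, y), edge_color (replay d0 F) E vs {vs ! s, vs ! t}) \<in> set ?r"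
      if "s < t" "t < n" "s \<in> back_neighbours E vs t" for s t
      using replay_edge[OF that, of F d0] unfolding dat_def g_def by blast
    have "proper_edge_coloring E (edge_color (replay d0 F) E vs)"
      unfolding proper_edge_coloring_def
    proof (intro ballI impI)
      fix e f assume ef: "e \<in> E" "f \<in> E" "e \<noteq> f \<and> e \<inter> f \<noteq> {}"
      obtain s t where e: "s < t" "t < n" "e = {vs ! s, vs ! t}" "s \<in> back_neighbours E vs t"
        using edge_cases[OF ef(1)] .
      obtain s' t' where f: "s' < t'" "t' < n" "f = {vs ! s', vs ! t'}" "s' \<in> back_neighbours E vs t'"
        using edge_cases[OF ef(2)] .
      obtain y where y: "((t, s, y), edge_color (replay d0 F) E vs e) \<in> set ?r"
        using col e by blast
      obtain y' where y': "((t', s', y'), edge_color (replay d0 F) E vs f) \<in> set ?r"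
        using col f by blast
      have "(s, t) \<noteq> (s', t')" using ef(3) e(3) f(3) by auto
      moreover have "{t, s} \<inter> {t', s'} \<noteq> {}"
        using ef(3) e f vs_facts by (auto simp: nth_eq_iff_index_eq)
      ultimately show "edge_color (replay d0 F) E vs e \<noteq> edge_color (replay d0 F) E vs f"
        using sorted_wrt_set[OF R.good_proper[OF gd] y y'] unfolding ends_def by auto
    qed
    moreover have "edge_color (replay d0 F) E vs ` E \<subseteq> {..<ncol (max_degree V E)}"
    proof
      fix k assume "k \<in> edge_color (replay d0 F) E vs ` E"
      then obtain e where e': "e \<in> E" "k = edge_color (replay d0 F) E vs e" by auto
      obtain s t where e: "s < t" "t < n" "e = {vs ! s, vs ! t}" "s \<in> back_neighbours E vs t"
        using edge_cases[OF e'(1)] .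
      obtain y where y: "((t, s, y), k) \<in> set ?r" using col e e'(2) by blast
      then have "(t, s, y) \<in> set (map fst ?r)" by force
      then have "(t, s, y) \<in> set dat" using map_fst_run[of F dat "[]"] by simp
      then obtain L where L: "y = level L (dmax_at d0 g t)"
        using edge_recs_elem[OF ok(1), of "(t, s, y)" d0] unfolding dat_def by auto
      have "d0 \<le> dmax_at d0 g t" unfolding dmax_at_def by (rule dmax_ge)
      then have "1000 \<le> dmax_at d0 g t" using d0(1) by linarith
      moreover have "y k \<noteq> 0" using R.good_support[OF gd y] by simp
      ultimately have "k < ncol (dmax_at d0 g t)" unfolding L by (rule level_support)
      also have "\<dots> \<le> ncol (max_degree V E)"
        unfolding dmax_at_def g_def
        by (rule ncol_mono[OF order_trans[OF dmax_drop_le dmax_ghist_le[OF d0(2)]]])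
      finally show "k \<in> {..<ncol (max_degree V E)}" by simp
    qed
    then have "card (edge_color (replay d0 F) E vs ` E) \<le> ncol (max_degree V E)"
      using card_mono[of "{..<ncol (max_degree V E)}"] by fastforce
    then have "real (card (edge_color (replay d0 F) E vs ` E)) \<le> 1.777 * real (max_degree V E)"
      using ncol_le[of "max_degree V E"] by linarith
    ultimately show ?thesis by simp
  qed
  have ld: "length dat \<le> n * n" unfolding dat_def using length_edge_recs[OF ok(1)] ok(2) by simp
  have dR: "set dat \<subseteq> rec_set n d0"
  proof -
    have "set g \<subseteq> Pow {..<n}" unfolding g_def ghist_def back_neighbours_def by auto
    then show ?thesis unfolding dat_def rec_set_def using ok(2) by blast
  qed
  have run: "map_pmf (\<lambda>F. run F dat []) ?P = color_process C dat []"
  proof (rule run_Pi_pmf[OF finite_keys _ _ dR C0])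
    show "(e, s) \<in> keys n d0" if "e \<in> set dat" "set s \<subseteq> rec_set n d0 \<times> {..<C}"
      "length s < length [] + length dat" for e s
      using that dR ld unfolding keys_def C_def by auto
  qed auto
  have len: "real (length dat) \<le> (real n)\<^sup>2"
    using of_nat_mono[OF ld, where 'a = real] by (simp add: power2_eq_square)
  have n1: "1 \<le> real n" using d0n d0 by simp
  have "real C \<le> 1 + 1.777 * real n" unfolding C_def palette_def using ncol_le[of n] d0n by (simp add: max_def)
  then have "real C \<le> 3 * real n" using n1 by simp
  then have "real n * real C \<le> real n * (3 * real n)" by (intro mult_left_mono) auto
  \<comment> \<open>At most \<open>3 * n\<close> colours give \<open>3 * n\<^sup>2\<close> terms for
    the pairs of vertex and colour, and at most \<open>n\<^sup>2\<close> edges with two tails give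
    \<open>2 * n\<^sup>2\<close> more.\<close>
  then have total_weight: "real n * real C + 2 * real (length dat) \<le> 5 * (real n)\<^sup>2"
    using len by (simp add: power2_eq_square)
  have "1 - 5 * (real n)\<^sup>2 * exp (- real d0 / 10^18) \<le> 1 - measure_pmf.prob (color_process C dat []) (- ?ok)"
    using R.color_process_good[OF C0] mult_right_mono[OF total_weight exp_ge_zero, of "- real d0 / 10^18"]
    unfolding Collect_neg_eq by linarith
  also have "\<dots> = measure_pmf.prob (color_process C dat []) ?ok"
    using measure_pmf.prob_compl[of ?ok "color_process C dat []"] by (simp add: Compl_eq_Diff_UNIV)
  also have "\<dots> = measure_pmf.prob ?P {F. run F dat [] \<in> ?ok}"
    unfolding run[symmetric] by (simp add: vimage_def)
  also have "\<dots> \<le> measure_pmf.prob ?P {F. replay d0 F \<in> ?S}"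
    using good by (intro measure_pmf.finite_measure_mono) auto
  also have "\<dots> = measure_pmf.prob (rounding_algorithm n d0) ?S"
    unfolding rounding_algorithm_def C_def by (simp add: vimage_def)
  finally show ?thesis .
qed

end

text \<open>Of the three extra powers of \<open>n\<close>, two absorb \<open>n\<^sup>2\<close> and
  the third absorbs the factor \<open>5\<close>.\<close>

lemma failure_le_powr:
  fixes n D :: real and c :: real
  assumes n: "5 \<le> n" and c: "0 < c" and big: "10^18 * (c + 3) * ln n \<le> D"
  shows "5 * n\<^sup>2 * exp (- D / 10^18) \<le> n powr (- c)"
proof -
    define X where "X = (c + 3) * ln n"
    have "10^18 * X \<le> D" unfolding X_def using big by (simp only: mult.assoc)
    then have "exp (- D / 10^18) \<le> exp (- X)" by simp
    also have "\<dots> = n powr (- c - 3)" unfolding X_def using n by (simp add: powr_def algebra_simps)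
    also have "\<dots> = n powr (- c) / n powr 3" by (rule powr_diff)
    also have "n powr 3 = n ^ 3" using n by (simp add: powr_numeral)
    finally have "5 * n\<^sup>2 * exp (- D / 10^18) \<le> 5 * n\<^sup>2 * (n powr (- c) / n ^ 3)"
      by (intro mult_left_mono) auto
    also have "\<dots> = 5 / n * n powr (- c)"
      using n by (simp add: power2_eq_square power3_eq_cube)
    also have "\<dots> \<le> 1 * n powr (- c)" using n by (intro mult_right_mono) auto
    finally show ?thesis by simp
qed

theorem theoremB11:
  "\<exists>A :: online_algorithm.
     \<forall>\<Delta>' :: nat \<Rightarrow> nat. (\<lambda>n. real (\<Delta>' n)) \<in> \<omega>(\<lambda>n. ln (real n)) \<longrightarrow>
       (\<exists>\<epsilon> :: nat \<Rightarrow> real. \<epsilon> \<in> o(\<lambda>_. 1) \<and>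
         (\<forall>c :: real. c > 0 \<longrightarrow>
           (\<forall>\<^sub>F n in sequentially.
             \<forall>(V :: nat set) E vs.
               simple_graph V E \<and> card V = n \<and> max_degree V E \<ge> \<Delta>' n \<and> arrival_order V vs \<longrightarrow>
               measure_pmf.prob (A n (\<Delta>' n))
                 {alg. proper_edge_coloring E (edge_color alg E vs) \<and>
                       real (card (edge_color alg E vs ` E))
                         \<le> (1.777 + \<epsilon> n) * real (max_degree V E)}
               \<ge> 1 - real n powr (- c))))"
\<comment> \<open>The error term is identically \<open>0\<close>, because \<open>ncol\<close> is at
  most \<open>1.777\<close> times the degree without any correction.\<close>
proof (intro exI[of _ rounding_algorithm] allI impI exI[of _ "\<lambda>_. 0"] conjI)
  fix \<Delta>' :: "nat \<Rightarrow> nat" and c :: real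
  assume om: "(\<lambda>n. real (\<Delta>' n)) \<in> \<omega>(\<lambda>n. ln (real n))" and c: "0 < c"
  have "eventually (\<lambda>n. norm (real (\<Delta>' n)) \<ge> (10^18 * (c + 3)) * norm (ln (real n))) sequentially"
    using om c by (intro landau_omega.smallD) auto
  then show "\<forall>\<^sub>F n in sequentially. \<forall>(V :: nat set) E vs.
               simple_graph V E \<and> card V = n \<and> max_degree V E \<ge> \<Delta>' n \<and> arrival_order V vs \<longrightarrow>
               measure_pmf.prob (rounding_algorithm n (\<Delta>' n))
                 {alg. proper_edge_coloring E (edge_color alg E vs) \<and>
                       real (card (edge_color alg E vs ` E))
                         \<le> (1.777 + 0) * real (max_degree V E)}
               \<ge> 1 - real n powr (- c)"
    using eventually_ge_at_top[of 5]
  proof eventually_elim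
    case (elim n)
    have n: "5 \<le> real n" using elim(2) by simp
    have "exp 1 \<le> (3 :: real)" by (rule exp_le)
    then have ln1: "1 \<le> ln (real n)" using n by (simp add: ln_ge_iff)
    have big: "10^18 * (c + 3) * ln (real n) \<le> real (\<Delta>' n)" using elim(1) ln1 by simp
    \<comment> \<open>The growth condition also makes the known bound exceed the threshold
      \<open>400000\<close>.\<close>
    have "10^18 * 3 * 1 \<le> 10^18 * (c + 3) * ln (real n)" using c ln1 by (intro mult_mono) auto
    then have "10^18 * 3 * 1 \<le> real (\<Delta>' n)" using big by (rule order_trans)
    then have D: "400000 \<le> \<Delta>' n" by simp
    note err = failure_le_powr[OF n c big]
    show ?case
    proof (intro allI impI)
      fix V :: "nat set" and E vs
      assume "simple_graph V E \<and> card V = n \<and> max_degree V E \<ge> \<Delta>' n \<and> arrival_order V vs"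
      then have G: "simple_graph V E" "card V = n" "arrival_order V vs" "\<Delta>' n \<le> max_degree V E" by auto
      show "1 - real n powr (- c) \<le> measure_pmf.prob (rounding_algorithm n (\<Delta>' n))
          {alg. proper_edge_coloring E (edge_color alg E vs) \<and>
            real (card (edge_color alg E vs ` E)) \<le> (1.777 + 0) * real (max_degree V E)}"
        using success[OF G(1-3) D G(4)] err by (simp only: add_0_right)
    qed
  qed
qed simp

end
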